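(* On any infinite dimensional separable Hilbert space $\mathcal{H}$, there exists an (operator) norm continuous semigroup of quantum operations $\mathbf{\Phi}=\{\Phi_t\}_{t\geq0}$ with respect to $\mathcal{H}$, for which: (a) The set of constants $\mathcal{C}^{\mathbf{\Phi}}$ is not a von Neumann algebra, equivalently, it is not stable under multiplication. (b) There exists a positive operator $A\in\mathcal{B}(\mathcal{H})$ which is a constant of $\mathbf{\Phi}$ but $A^2$ is not.
   Context: $\mathcal{B}(\mathcal{H})$ is the algebra of bounded operators on $\mathcal{H}$ and $\mathcal{B}_1(\mathcal{H})$ the trace class. A quantum operation with respect to $\mathcal{H}$ is a completely positive, trace-preserving linear map $\mathcal{B}_1(\mathcal{H})\to\mathcal{B}_1(\mathcal{H})$. A norm continuous semigroup of quantum operations is a family $\{\Phi_t\}_{t\ge0}$ of quantum operations with $\Phi_s\Phi_t=\Phi_{s+t}$, $\Phi_0=I$, and $t\mapsto\Phi_t$ continuous on $[0,\infty)$ with respect to the operator norm of bounded linear operators on $(\mathcal{B}_1(\mathcal{H}),\|\cdot\|_1)$. An operator $A\in\mathcal{B}(\mathcal{H})$ is a constant of $\mathbf{\Phi}$ if for every density operator $\rho$ (positive trace-class operator of trace $1$) one has $\operatorname{tr}(\Phi_t(\rho)A)=\operatorname{tr}(\rho A)$ for all $t\ge0$; $\mathcal{C}^{\mathbf{\Phi}}$ is the set of all constants of $\mathbf{\Phi}$. *)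

theory Defs
  imports "HOL-Analysis.Analysis"
begin

section \<open>Complex Hilbert spaces\<close>

text \<open>
  A complex Hilbert space is a complete real inner product space together with a
  complex scalar multiplication extending the real one and a complex inner product,
  conjugate linear in its first argument, whose real part is the real inner product.
  Norm and topology are therefore those of \<open>cinner\<close>: definiteness, and
  \<open>(norm x)\<^sup>2 = cinner x x\<close>, are inherited from \<^class>\<open>real_inner\<close>.
\<close>

class complex_inner = real_inner +
  fixes scaleC :: "complex \<Rightarrow> 'a \<Rightarrow> 'a" (infixr "*\<^sub>C" 75)
    and cinner :: "'a \<Rightarrow> 'a \<Rightarrow> complex"
  assumes scaleC_add_right: "c *\<^sub>C (x + y) = c *\<^sub>C x + c *\<^sub>C y"
    and scaleC_add_left: "(c + d) *\<^sub>C x = c *\<^sub>C x + d *\<^sub>C x"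
    and scaleC_scaleC: "c *\<^sub>C (d *\<^sub>C x) = (c * d) *\<^sub>C x"
    and scaleC_of_real: "complex_of_real r *\<^sub>C x = r *\<^sub>R x"
    and cinner_commute: "cinner x y = cnj (cinner y x)"
    and cinner_add_right: "cinner x (y + z) = cinner x y + cinner x z"
    and cinner_scaleC_right: "cinner x (c *\<^sub>C y) = c * cinner x y"
    and Re_cinner: "Re (cinner x y) = inner x y"

class chilbert_space = complex_inner + complete_space

lemma scaleC_one: "1 *\<^sub>C (x :: 'a::complex_inner) = x"
  using scaleC_of_real[of 1 x] by simp

global_interpretation complex_vector: vector_space "scaleC :: complex \<Rightarrow> 'a::complex_inner \<Rightarrow> 'a"
  defines cspan = complex_vector.span
  by unfold_locales
    (simp_all add: scaleC_add_right scaleC_add_left scaleC_scaleC scaleC_one)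

definition is_onb :: "'a::complex_inner set \<Rightarrow> bool" where
  "is_onb E \<longleftrightarrow> (\<forall>e\<in>E. norm e = 1) \<and> (\<forall>e\<in>E. \<forall>f\<in>E. e \<noteq> f \<longrightarrow> cinner e f = 0)
     \<and> closure (cspan E) = UNIV"


section \<open>Bounded operators\<close>

text \<open>
  The library type \<open>'a \<Rightarrow>\<^sub>L 'a\<close> consists of the bounded real-linear maps;
  \<open>bounded_ops\<close> is its subset of complex-linear maps.
\<close>

definition bounded_ops :: "('a::complex_inner \<Rightarrow>\<^sub>L 'a) set" where
  "bounded_ops = {A. \<forall>c x. blinfun_apply A (c *\<^sub>C x) = c *\<^sub>C blinfun_apply A x}"

lemma norm_scaleC: "norm (c *\<^sub>C (x :: 'a::complex_inner)) = cmod c * norm x"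
proof -
  have im: "Im (cinner x x) = 0"
    using arg_cong[OF cinner_commute[of x x], of Im] by simp
  have re: "Re (cinner x x) = (norm x)\<^sup>2"
    by (simp add: Re_cinner power2_norm_eq_inner)
  have "cinner (c *\<^sub>C x) (c *\<^sub>C x) = (c * cnj c) * cinner x x"
    by (metis cinner_commute cinner_scaleC_right complex_cnj_mult complex_cnj_cnj
        mult.assoc mult.commute)
  then have "(norm (c *\<^sub>C x))\<^sup>2 = Re ((c * cnj c) * cinner x x)"
    by (metis Re_cinner power2_norm_eq_inner)
  also have "\<dots> = (cmod c * norm x)\<^sup>2"
    by (simp add: im re complex_norm_square[symmetric] cmod_power2 power_mult_distrib power2_eq_square)
  finally show ?thesis
    by (metis norm_ge_zero mult_nonneg_nonneg power2_eq_iff_nonneg)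
qed

lemma bounded_linear_scaleC: "bounded_linear (\<lambda>x :: 'a::complex_inner. c *\<^sub>C x)"
proof (rule bounded_linear_intro[where K = "cmod c"])
  show "c *\<^sub>C (r *\<^sub>R x) = r *\<^sub>R (c *\<^sub>C x)" for r and x :: 'a
    by (simp add: scaleC_of_real[symmetric] scaleC_scaleC mult.commute)
qed (simp_all add: scaleC_add_right norm_scaleC)

lift_definition scaleC_op :: "complex \<Rightarrow> ('a::complex_inner \<Rightarrow>\<^sub>L 'a) \<Rightarrow> 'a \<Rightarrow>\<^sub>L 'a"
  is "\<lambda>c A x. c *\<^sub>C A x"
  by (rule bounded_linear_compose[OF bounded_linear_scaleC])

definition positive_op :: "('a::complex_inner \<Rightarrow>\<^sub>L 'a) \<Rightarrow> bool" where
  "positive_op A \<longleftrightarrow> A \<in> bounded_ops \<and> (\<forall>x. cinner x (blinfun_apply A x) \<in> \<real>\<^sub>\<ge>\<^sub>0)"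

definition adjoint_op :: "('a::chilbert_space \<Rightarrow>\<^sub>L 'a) \<Rightarrow> 'a \<Rightarrow>\<^sub>L 'a" where
  "adjoint_op A = (THE B. \<forall>x y. cinner (blinfun_apply B x) y = cinner x (blinfun_apply A y))"

text \<open>The absolute value is the unique positive square root of \<open>A\<^sup>* A\<close>.\<close>

definition abs_op :: "('a::chilbert_space \<Rightarrow>\<^sub>L 'a) \<Rightarrow> 'a \<Rightarrow>\<^sub>L 'a" where
  "abs_op A = (THE P. positive_op P \<and> P o\<^sub>L P = adjoint_op A o\<^sub>L A)"

text \<open>
  Closedness in the strong operator topology may be taken inside the larger space of
  bounded real-linear maps, since \<^const>\<open>bounded_ops\<close> is itself closed there.
\<close>

definition von_neumann_algebra :: "('a::chilbert_space \<Rightarrow>\<^sub>L 'a) set \<Rightarrow> bool" where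
  "von_neumann_algebra M \<longleftrightarrow>
     M \<subseteq> bounded_ops \<and> id_blinfun \<in> M \<and>
     (\<forall>A\<in>M. \<forall>B\<in>M. A + B \<in> M) \<and>
     (\<forall>c. \<forall>A\<in>M. scaleC_op c A \<in> M) \<and>
     (\<forall>A\<in>M. \<forall>B\<in>M. A o\<^sub>L B \<in> M) \<and>
     (\<forall>A\<in>M. adjoint_op A \<in> M) \<and>
     closedin strong_operator_topology M"


section \<open>Trace class operators\<close>

text \<open>
  Neither summability below nor the value of the trace depends on the choice of the
  orthonormal basis.
\<close>

definition trace_class :: "('a::chilbert_space \<Rightarrow>\<^sub>L 'a) set" where
  "trace_class = {A \<in> bounded_ops.
     \<exists>E. is_onb E \<and> (\<lambda>e. cinner e (blinfun_apply (abs_op A) e)) summable_on E}"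

definition some_onb :: "'a::chilbert_space set" where
  "some_onb = (SOME E. is_onb E)"

definition trace_op :: "('a::chilbert_space \<Rightarrow>\<^sub>L 'a) \<Rightarrow> complex" where
  "trace_op A = (\<Sum>\<^sub>\<infinity>e\<in>some_onb. cinner e (blinfun_apply A e))"

definition trace_norm :: "('a::chilbert_space \<Rightarrow>\<^sub>L 'a) \<Rightarrow> real" where
  "trace_norm A = Re (trace_op (abs_op A))"

definition density_operator :: "('a::chilbert_space \<Rightarrow>\<^sub>L 'a) \<Rightarrow> bool" where
  "density_operator \<rho> \<longleftrightarrow> \<rho> \<in> trace_class \<and> positive_op \<rho> \<and> trace_op \<rho> = 1"


section \<open>Quantum operations\<close>

text \<open>
  A linear map on the trace class is represented by a function on \<open>'a \<Rightarrow>\<^sub>L 'a\<close> of which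
  only the values on \<^const>\<open>trace_class\<close> matter.
\<close>

type_synonym 'a superop = "('a \<Rightarrow>\<^sub>L 'a) \<Rightarrow> ('a \<Rightarrow>\<^sub>L 'a)"

definition linear_on_trace_class :: "'a::chilbert_space superop \<Rightarrow> bool" where
  "linear_on_trace_class \<Psi> \<longleftrightarrow>
     (\<forall>\<rho>\<in>trace_class. \<Psi> \<rho> \<in> trace_class) \<and>
     (\<forall>\<rho>\<in>trace_class. \<forall>\<sigma>\<in>trace_class. \<Psi> (\<rho> + \<sigma>) = \<Psi> \<rho> + \<Psi> \<sigma>) \<and>
     (\<forall>c. \<forall>\<rho>\<in>trace_class. \<Psi> (scaleC_op c \<rho>) = scaleC_op c (\<Psi> \<rho>))"

text \<open>
  Positivity of the operator on \<open>H\<^sup>n\<close> whose \<open>n \<times> n\<close> block matrix is \<open>R\<close>.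
  Complete positivity then says that every ampliation \<open>id \<otimes> \<Psi>\<close> to \<open>n \<times> n\<close> block
  matrices with trace class entries, i.e. to the trace class of \<open>H\<^sup>n\<close>, is positive.
\<close>

definition block_positive :: "nat \<Rightarrow> (nat \<Rightarrow> nat \<Rightarrow> 'a::complex_inner \<Rightarrow>\<^sub>L 'a) \<Rightarrow> bool" where
  "block_positive n R \<longleftrightarrow>
     (\<forall>x. (\<Sum>i<n. \<Sum>j<n. cinner (x i) (blinfun_apply (R i j) (x j))) \<in> \<real>\<^sub>\<ge>\<^sub>0)"

definition completely_positive :: "'a::chilbert_space superop \<Rightarrow> bool" where
  "completely_positive \<Psi> \<longleftrightarrow>
     (\<forall>n R. (\<forall>i<n. \<forall>j<n. R i j \<in> trace_class) \<and> block_positive n R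
        \<longrightarrow> block_positive n (\<lambda>i j. \<Psi> (R i j)))"

definition trace_preserving :: "'a::chilbert_space superop \<Rightarrow> bool" where
  "trace_preserving \<Psi> \<longleftrightarrow> (\<forall>\<rho>\<in>trace_class. trace_op (\<Psi> \<rho>) = trace_op \<rho>)"

definition quantum_operation :: "'a::chilbert_space superop \<Rightarrow> bool" where
  "quantum_operation \<Psi> \<longleftrightarrow>
     linear_on_trace_class \<Psi> \<and> completely_positive \<Psi> \<and> trace_preserving \<Psi>"

text \<open>
  The operator norm with respect to \<^const>\<open>trace_norm\<close>, as a supremum over the closed
  unit ball; it is extended-valued, so that it is infinite exactly on unbounded maps.
\<close>

definition superop_norm :: "'a::chilbert_space superop \<Rightarrow> ennreal" where
  "superop_norm \<Psi> = (SUP \<rho>\<in>{\<rho>\<in>trace_class. trace_norm \<rho> \<le> 1}. ennreal (trace_norm (\<Psi> \<rho>)))"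

definition norm_continuous_quantum_semigroup :: "(real \<Rightarrow> 'a::chilbert_space superop) \<Rightarrow> bool" where
  "norm_continuous_quantum_semigroup \<Phi> \<longleftrightarrow>
     (\<forall>t\<ge>0. quantum_operation (\<Phi> t)) \<and>
     (\<forall>s\<ge>0. \<forall>t\<ge>0. \<forall>\<rho>\<in>trace_class. \<Phi> s (\<Phi> t \<rho>) = \<Phi> (s + t) \<rho>) \<and>
     (\<forall>\<rho>\<in>trace_class. \<Phi> 0 \<rho> = \<rho>) \<and>
     (\<forall>t\<ge>0. superop_norm (\<Phi> t) < \<infinity>) \<and>
     (\<forall>t\<ge>0. ((\<lambda>s. superop_norm (\<lambda>\<rho>. \<Phi> s \<rho> - \<Phi> t \<rho>)) \<longlongrightarrow> 0) (at t within {0..}))"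

definition constants :: "(real \<Rightarrow> 'a::chilbert_space superop) \<Rightarrow> ('a \<Rightarrow>\<^sub>L 'a) set" where
  "constants \<Phi> = {A \<in> bounded_ops.
     \<forall>\<rho>. density_operator \<rho> \<longrightarrow>
       (\<forall>t\<ge>0. trace_op (\<Phi> t \<rho> o\<^sub>L A) = trace_op (\<rho> o\<^sub>L A))}"

end

theory Submission
  imports Defs
begin

text \<open>
  The example is a quantum version of a Markov chain with two absorbing states: the conserved
  quantities of such a chain are its harmonic functions, and the square of a harmonic function
  is in general not harmonic.

  Let \<open>e\<close> and \<open>f\<close> be two vectors of an orthonormal basis. The quantum operation \<open>\<Psi>\<close> given by
  \<open>\<Psi> \<rho> = a P\<^sub>e + b P\<^sub>f\<close>, with \<open>a = tr (\<rho> Q)\<close>, \<open>b = tr (\<rho> (1 - Q))\<close> and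
  \<open>Q = (1 + P\<^sub>e - P\<^sub>f) / 2\<close>, keeps \<open>e\<close> and \<open>f\<close> and sends every state orthogonal to both to
  \<open>(P\<^sub>e + P\<^sub>f) / 2\<close>. It is idempotent, so \<open>\<Phi>\<^sub>t = exp (- t) I + (1 - exp (- t)) \<Psi>\<close> is a norm
  continuous semigroup of quantum operations, and its constants are those \<open>A\<close> with
  \<open>tr (\<Psi> \<rho> A) = tr (\<rho> A)\<close> for all states. The probability \<open>a\<close> does not change under \<open>\<Psi>\<close>, so
  the positive operator \<open>Q\<close> is a constant. Its square has the eigenvalues 1 at \<open>e\<close>, 0 at \<open>f\<close> and
  \<open>1/4\<close> at any third basis vector \<open>k\<close>; since \<open>\<Psi> P\<^sub>k = (P\<^sub>e + P\<^sub>f) / 2\<close> and \<open>(1 + 0) / 2 \<noteq> 1/4\<close>, it is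
  not a constant. A set of constants that is not closed under products is not an algebra.

  Most of the work lies in the trace class itself. The absolute value and the polar decomposition
  come from \<open>riesz_representation_range\<close>, \<open>douglas_factorisation\<close> and the square root iteration
  \<open>square_root_iteration_limit\<close>. The duality \<open>trace_class_iff\<close> then describes the trace class and
  its norm by the sums \<open>\<Sum> \<bar>\<langle>W e, A e\<rangle>\<bar>\<close> over contractions \<open>W\<close> and finite orthonormal sets,
  which makes linearity, the triangle inequality and absolute convergence of the trace
  immediate.
\<close>

section \<open>Geometry of complex inner products\<close>

lemma cinner_add_left: "cinner (x + y) z = cinner x z + cinner y (z :: 'a::complex_inner)"
  by (metis cinner_commute cinner_add_right complex_cnj_add)

lemma cinner_scaleC_left: "cinner (c *\<^sub>C x) y = cnj c * cinner x (y :: 'a::complex_inner)"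
  by (metis cinner_commute cinner_scaleC_right complex_cnj_mult)

lemma cinner_self: "cinner x x = complex_of_real ((norm (x :: 'a::complex_inner))\<^sup>2)"
proof (rule complex_eqI)
  show "Im (cinner x x) = Im (complex_of_real ((norm x)\<^sup>2))"
    using arg_cong[OF cinner_commute[of x x], of Im] by simp
qed (simp add: Re_cinner power2_norm_eq_inner)

lemma cmod_cinner_le: "cmod (cinner x y) \<le> norm x * norm (y :: 'a::complex_inner)"
proof (cases "cinner x y = 0")
  case False
  define c where "c = cnj (sgn (cinner x y))"
  have c: "cmod c = 1"
    using False by (simp add: c_def norm_sgn)
  have "c * cinner x y = complex_of_real (cmod (cinner x y))"
    using False complex_norm_square[of "cinner x y"]
    by (simp add: c_def sgn_eq mult.commute power2_eq_square divide_eq_eq)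
  then have "cmod (cinner x y) = inner x (c *\<^sub>C y)"
    by (metis Re_cinner Re_complex_of_real cinner_scaleC_right)
  also have "\<dots> \<le> norm x * norm (c *\<^sub>C y)"
    by (rule norm_cauchy_schwarz)
  finally show ?thesis
    by (simp add: norm_scaleC c)
qed simp

lemma bounded_bilinear_cinner: "bounded_bilinear (cinner :: 'a::complex_inner \<Rightarrow> _)"
proof
  show "cinner (r *\<^sub>R x) y = r *\<^sub>R cinner x y" and "cinner x (r *\<^sub>R y) = r *\<^sub>R cinner x y"
    for r and x y :: 'a
    by (simp_all add: scaleC_of_real[symmetric] cinner_scaleC_left cinner_scaleC_right scaleR_conv_of_real)
  show "\<exists>K. \<forall>x y :: 'a. norm (cinner x y) \<le> norm x * norm y * K"
    by (rule exI[of _ 1]) (simp add: cmod_cinner_le)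
qed (simp_all add: cinner_add_left cinner_add_right)

interpretation cinner: bounded_bilinear "cinner :: 'a::complex_inner \<Rightarrow> _"
  by (rule bounded_bilinear_cinner)

lemma bounded_bilinear_scaleC: "bounded_bilinear (scaleC :: complex \<Rightarrow> 'a::complex_inner \<Rightarrow> 'a)"
proof
  show "(r *\<^sub>R c) *\<^sub>C x = r *\<^sub>R (c *\<^sub>C x)" and "c *\<^sub>C (r *\<^sub>R x) = r *\<^sub>R (c *\<^sub>C x)"
    for r c and x :: 'a
    by (simp_all add: scaleC_of_real[symmetric] scaleC_scaleC scaleR_conv_of_real mult.commute)
  show "\<exists>K. \<forall>c (x :: 'a). norm (c *\<^sub>C x) \<le> norm c * norm x * K"
    by (rule exI[of _ 1]) (simp add: norm_scaleC)
qed (simp_all add: scaleC_add_left scaleC_add_right)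

interpretation scaleC: bounded_bilinear "scaleC :: complex \<Rightarrow> 'a::complex_inner \<Rightarrow> 'a"
  by (rule bounded_bilinear_scaleC)

lemma Im_cinner: "Im (cinner x y) = - inner x (\<i> *\<^sub>C (y :: 'a::complex_inner))"
  by (simp add: Re_cinner[symmetric] cinner_scaleC_right)

lemma cinner_ext:
  assumes "\<And>y. cinner u y = cinner v y"
  shows "u = (v :: 'a::complex_inner)"
  using assms[of "u - v"] cinner_self[of "u - v"] by (simp add: cinner.diff_left)

text \<open>
  The imaginary part of \<open>cinner u (P y)\<close> is, up to sign, \<open>inner u (P (\<i> *\<^sub>C y))\<close>, so an
  identity of real inner products valid for all \<open>y\<close> lifts to the complex ones.
\<close>

lemma cinner_eq_of_inner_eq:
  assumes "\<And>y. inner u (P y) = inner v (A y)"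
    and "\<And>c y. P (c *\<^sub>C y) = c *\<^sub>C P y" "\<And>c y. A (c *\<^sub>C y) = c *\<^sub>C A y"
  shows "cinner u (P y) = cinner v (A y :: 'a::complex_inner)"
  using assms(1)[of y] assms(1)[of "\<i> *\<^sub>C y"]
  by (intro complex_eqI) (simp_all add: Re_cinner Im_cinner assms(2,3))

lemma bounded_ops_scaleC: "A \<in> bounded_ops \<Longrightarrow> A (c *\<^sub>C x) = c *\<^sub>C A x"
  by (simp add: bounded_ops_def)

section \<open>Riesz representation and factorisation of operators\<close>

text \<open>
  The form of the Riesz theorem used below: a functional dominated on \<open>V\<close> by \<open>norm (T x)\<close>
  is represented by a vector in the closure of the image of \<open>V\<close>. Minimising
  \<open>(norm (T x))\<^sup>2 - 2 * g x\<close> yields it: by the parallelogram law the images under \<open>T\<close> of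
  a minimising sequence converge, and the vanishing of the first variation at the limit
  is the claimed identity. With \<open>T\<close> the identity it also gives the projection onto
  the closure of \<open>V\<close>.
\<close>

lemma riesz_representation_range:
  fixes T :: "'b::real_vector \<Rightarrow> 'a::{real_inner,complete_space}"
  assumes V: "subspace V" and T: "linear T" and g: "linear g"
    and bound: "\<And>x. x \<in> V \<Longrightarrow> \<bar>g x\<bar> \<le> C * norm (T x)" and C: "C \<ge> 0"
  obtains z where "z \<in> closure (T ` V)" "\<And>x. x \<in> V \<Longrightarrow> inner z (T x) = g x" "norm z \<le> C"
proof -
  interpret T: linear T by (rule T)
  interpret g: linear g by (rule g)
  define J where "J x = (norm (T x))\<^sup>2 - 2 * g x" for x
  define m where "m = (INF x\<in>V. J x)"
  have lower: "- C\<^sup>2 \<le> J x" if "x \<in> V" for x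
  proof -
    have "0 \<le> (norm (T x) - C)\<^sup>2" by simp
    then show ?thesis
      using bound[OF that] unfolding J_def power2_diff by (simp add: mult.commute)
  qed
  have bdd: "bdd_below (J ` V)"
    using lower by (auto intro!: bdd_belowI)
  have ne: "J ` V \<noteq> {}"
    using subspace_0[OF V] by auto
  have m_le: "m \<le> J x" if "x \<in> V" for x
    unfolding m_def using bdd that by (rule cINF_lower)
  have "\<exists>x\<in>V. J x < m + 1 / real (Suc n)" for n
    using cInf_lessD[OF ne, of "m + 1 / real (Suc n)"] unfolding m_def by auto
  then obtain X where XV: "\<And>n. X n \<in> V" and XJ: "\<And>n. J (X n) < m + 1 / real (Suc n)"
    by metis
  have par: "(norm (T x - T y))\<^sup>2 \<le> 2 * (J x - m) + 2 * (J y - m)" if "x \<in> V" "y \<in> V" for x y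
  proof -
    have "(1/2) *\<^sub>R (x + y) \<in> V"
      using that V by (intro subspace_scale subspace_add)
    from m_le[OF this] have "m \<le> (norm ((1/2) *\<^sub>R (T x + T y)))\<^sup>2 - (g x + g y)"
      unfolding J_def T.add T.scale g.add g.scale by (simp add: field_simps)
    moreover have "(norm ((1/2) *\<^sub>R (T x + T y)))\<^sup>2 = (norm (T x + T y))\<^sup>2 / 4"
      by (simp add: power2_eq_square)
    moreover have "(norm (T x + T y))\<^sup>2 + (norm (T x - T y))\<^sup>2 = 2 * (norm (T x))\<^sup>2 + 2 * (norm (T y))\<^sup>2"
      by (simp add: power2_norm_eq_inner inner_simps inner_commute)
    moreover have "D \<le> 2 * (a - 2 * p - m) + 2 * (b - 2 * q - m)"
      if "m \<le> N - (p + q)" "N = Q / 4" "Q + D = 2 * a + 2 * b" for N Q D a b p q :: real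
      using that by argo
    ultimately show ?thesis
      unfolding J_def by blast
  qed
  have lim0: "(\<lambda>n. 1 / real (Suc n)) \<longlonglongrightarrow> 0"
    using LIMSEQ_inverse_real_of_nat by (simp add: inverse_eq_divide)
  have "Cauchy (\<lambda>n. T (X n))"
  proof (rule metric_CauchyI)
    fix e :: real assume e: "0 < e"
    have "\<forall>\<^sub>F n in sequentially. 1 / real (Suc n) < e\<^sup>2 / 4"
      using order_tendstoD(2)[OF lim0, of "e\<^sup>2 / 4"] e by simp
    then obtain N where N: "\<And>n. n \<ge> N \<Longrightarrow> 1 / real (Suc n) < e\<^sup>2 / 4"
      unfolding eventually_sequentially by blast
    show "\<exists>M. \<forall>m\<ge>M. \<forall>n\<ge>M. dist (T (X m)) (T (X n)) < e"
    proof (intro exI allI impI)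
      fix k n assume k: "k \<ge> N" and n: "n \<ge> N"
      have "(norm (T (X k) - T (X n)))\<^sup>2 < e\<^sup>2"
        using par[OF XV XV, of k n] XJ[of k] XJ[of n] N[OF k] N[OF n] by argo
      then show "dist (T (X k)) (T (X n)) < e"
        using e by (simp add: dist_norm power_less_imp_less_base)
    qed
  qed
  then obtain z where z: "(\<lambda>n. T (X n)) \<longlonglongrightarrow> z"
    using Cauchy_convergent_iff convergent_def by blast
  have Jm: "(\<lambda>n. J (X n)) \<longlonglongrightarrow> m"
  proof (rule tendsto_sandwich[OF _ _ tendsto_const])
    show "(\<lambda>n. m + 1 / real (Suc n)) \<longlonglongrightarrow> m"
      using tendsto_add[OF tendsto_const lim0] by simp
    show "\<forall>\<^sub>F n in sequentially. m \<le> J (X n)"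
      by (intro always_eventually allI m_le XV)
    show "\<forall>\<^sub>F n in sequentially. J (X n) \<le> m + 1 / real (Suc n)"
      by (intro always_eventually allI less_imp_le XJ)
  qed
  have inner_z: "inner z (T x) = g x" if x: "x \<in> V" for x
  proof -
    define b where "b = inner z (T x) - g x"
    have pos: "0 \<le> 2 * t * b + t\<^sup>2 * (norm (T x))\<^sup>2" for t
    proof -
      have expand: "J (X n + t *\<^sub>R x)
          = J (X n) + 2 * t * (inner (T (X n)) (T x) - g x) + t\<^sup>2 * (norm (T x))\<^sup>2" for n
        unfolding J_def power2_norm_eq_inner
        by (simp add: T.add T.scale g.add g.scale inner_simps inner_commute algebra_simps power2_eq_square)
      have "(\<lambda>n. J (X n + t *\<^sub>R x)) \<longlonglongrightarrow> m + 2 * t * b + t\<^sup>2 * (norm (T x))\<^sup>2"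
        unfolding expand b_def by (intro tendsto_intros Jm z)
      moreover have "m \<le> J (X n + t *\<^sub>R x)" for n
        by (intro m_le subspace_add subspace_scale V XV x)
      ultimately have "m \<le> m + 2 * t * b + t\<^sup>2 * (norm (T x))\<^sup>2"
        by (meson LIMSEQ_le_const)
      then show ?thesis by simp
    qed
    \<comment> \<open>\<open>t = - b / k\<close> nearly minimises the quadratic; the summand 1 in \<open>k\<close> excludes division by zero.\<close>
    define k where "k = 1 + (norm (T x))\<^sup>2"
    have k: "k \<ge> 1" by (simp add: k_def)
    have "0 \<le> 2 * (- b / k) * b + (- b / k)\<^sup>2 * (k - 1)"
      using pos[of "- b / k"] by (simp add: k_def)
    also have "\<dots> = - (b\<^sup>2 / k\<^sup>2) * (k + 1)"
      using k by (simp add: field_simps power2_eq_square)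
    finally have "b\<^sup>2 / k\<^sup>2 * (k + 1) \<le> 0" by simp
    then have "b\<^sup>2 / k\<^sup>2 \<le> 0"
      using k unfolding mult_le_0_iff by linarith
    then have "b = 0"
      using k by (auto simp: divide_le_0_iff)
    then show ?thesis by (simp add: b_def)
  qed
  have "norm z * norm z \<le> C * norm z"
  proof -
    have "(\<lambda>n. inner z (T (X n))) \<longlonglongrightarrow> inner z z" and "(\<lambda>n. C * norm (T (X n))) \<longlonglongrightarrow> C * norm z"
      by (intro tendsto_intros z)+
    moreover have "inner z (T (X n)) \<le> C * norm (T (X n))" for n
      using bound[OF XV[of n]] inner_z[OF XV[of n]] by simp
    ultimately have "inner z z \<le> C * norm z"
      by (meson LIMSEQ_le)
    then show ?thesis by (simp add: power2_norm_eq_inner[symmetric] power2_eq_square)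
  qed
  then have "norm z \<le> C"
    using C by (cases "norm z = 0") (auto simp: mult_le_cancel_right)
  moreover have "z \<in> closure (T ` V)"
    unfolding closure_sequential using z XV by (intro exI[of _ "\<lambda>n. T (X n)"]) auto
  ultimately show ?thesis
    using that inner_z by blast
qed

lemma subspace_closure_range:
  fixes P :: "'a::real_normed_vector \<Rightarrow>\<^sub>L 'b::real_normed_vector"
  shows "subspace (closure (range P))"
proof (rule subspaceI)
  have sub: "subspace (range P)"
    by (intro linear_subspace_image bounded_linear.linear[OF blinfun.bounded_linear_right] subspace_UNIV)
  then show "0 \<in> closure (range P)"
    using closure_subset subspace_0 by blast
  show "x + y \<in> closure (range P)" if x: "x \<in> closure (range P)" and y: "y \<in> closure (range P)" for x y
  proof -
    obtain X where "\<forall>n. X n \<in> range P" "X \<longlonglongrightarrow> x"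
      using x unfolding closure_sequential by blast
    moreover obtain Y where "\<forall>n. Y n \<in> range P" "Y \<longlonglongrightarrow> y"
      using y unfolding closure_sequential by blast
    ultimately show ?thesis
      unfolding closure_sequential
      by (intro exI[of _ "\<lambda>n. X n + Y n"] conjI allI subspace_add[OF sub] tendsto_add) simp_all
  qed
  show "c *\<^sub>R x \<in> closure (range P)" if x: "x \<in> closure (range P)" for c x
  proof -
    obtain X where "\<forall>n. X n \<in> range P" "X \<longlonglongrightarrow> x"
      using x unfolding closure_sequential by blast
    then show ?thesis
      unfolding closure_sequential
      by (intro exI[of _ "\<lambda>n. c *\<^sub>R X n"] conjI allI subspace_scale[OF sub] tendsto_scaleR) simp_all
  qed
qed

lemma closure_range_orthogonal_unique:
  fixes P :: "'a::real_inner \<Rightarrow>\<^sub>L 'b::real_inner"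
  assumes "u \<in> closure (range P)" "v \<in> closure (range P)" "\<And>x. inner u (P x) = inner v (P x)"
  shows "u = v"
proof -
  note sub = subspace_closure_range[of P]
  have "closed {w. inner (u - v) w = 0}"
    by (intro closed_Collect_eq continuous_intros)
  moreover have "range P \<subseteq> {w. inner (u - v) w = 0}"
    using assms(3) by (auto simp: inner_diff_left)
  ultimately have "closure (range P) \<subseteq> {w. inner (u - v) w = 0}"
    by (rule closure_minimal[rotated])
  with subspace_diff[OF sub assms(1,2)] show ?thesis by auto
qed

text \<open>
  Douglas' factorisation lemma. The bound makes \<open>P x \<mapsto> A x\<close> a well-defined bounded map
  on the range of \<open>P\<close>, whose adjoint is \<open>V\<close>. It gives adjoints when \<open>P\<close> is the
  identity and the polar decomposition when \<open>P\<close> is the absolute value of \<open>A\<close>.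
\<close>

lemma douglas_factorisation:
  fixes P A :: "'a::chilbert_space \<Rightarrow>\<^sub>L 'a"
  assumes P: "P \<in> bounded_ops" and A: "A \<in> bounded_ops"
    and le: "\<And>x. norm (A x) \<le> K * norm (P x)" and K: "K \<ge> 0"
  obtains V where "V \<in> bounded_ops" "norm V \<le> K" "\<And>x y. cinner (V y) (P x) = cinner y (A x)"
    "\<And>y. V y \<in> closure (range P)"
proof -
  have "\<exists>z. z \<in> closure (range P) \<and> (\<forall>x. inner z (P x) = inner y (A x)) \<and> norm z \<le> norm y * K" for y
  proof (rule riesz_representation_range[of UNIV P "\<lambda>x. inner y (A x)" "norm y * K"])
    show "\<bar>inner y (A x)\<bar> \<le> norm y * K * norm (P x)" for x
      using Cauchy_Schwarz_ineq2[of y "A x"] mult_left_mono[OF le[of x] norm_ge_zero[of y]]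
      by (simp add: mult.assoc)
    show "linear (\<lambda>x. inner y (A x))"
      by (intro bounded_linear.linear bounded_linear_intros)
  qed (use K in \<open>auto intro!: bounded_linear.linear blinfun.bounded_linear_right\<close>)
  then obtain v where v_cl: "\<And>y. v y \<in> closure (range P)"
    and v: "\<And>x y. inner (v y) (P x) = inner y (A x)" and v_norm: "\<And>y. norm (v y) \<le> norm y * K"
    by metis
  have vc: "cinner (v y) (P x) = cinner y (A x)" for x y
    by (rule cinner_eq_of_inner_eq) (auto simp: v P A bounded_ops_scaleC)
  note sub = subspace_closure_range[of P]
  have cl_scaleC: "c *\<^sub>C u \<in> closure (range P)" if "u \<in> closure (range P)" for c u
  proof -
    have "(\<lambda>x. c *\<^sub>C x) ` closure (range P) \<subseteq> closure (range P)"
      by (rule image_closure_subset)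
        (auto intro!: linear_continuous_on bounded_linear_scaleC
          intro: subsetD[OF closure_subset] simp: bounded_ops_scaleC[OF P, symmetric])
    then show ?thesis using that by blast
  qed
  have add: "v (x + y) = v x + v y" for x y
    by (rule closure_range_orthogonal_unique[of _ P])
      (auto intro: v_cl subspace_add[OF sub] simp: v inner_add_left)
  have scaleC: "v (c *\<^sub>C y) = c *\<^sub>C v y" for c y
  proof (rule closure_range_orthogonal_unique[of _ P])
    show "inner (v (c *\<^sub>C y)) (P x) = inner (c *\<^sub>C v y) (P x)" for x
      by (simp add: Re_cinner[symmetric] vc cinner_scaleC_left)
  qed (auto intro: v_cl cl_scaleC)
  have "bounded_linear v"
    by (rule bounded_linear_intro[where K = K])
      (auto simp: add scaleC scaleC_of_real[symmetric] v_norm)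
  then have app: "blinfun_apply (Blinfun v) = v"
    by (rule bounded_linear_Blinfun_apply)
  show ?thesis
  proof (rule that[of "Blinfun v"])
    show "norm (Blinfun v) \<le> K"
      by (rule norm_blinfun_bound) (use K v_norm in \<open>auto simp: app mult.commute\<close>)
  qed (auto simp: app vc v_cl bounded_ops_def scaleC)
qed

section \<open>Adjoints and positive operators\<close>

lemma adjoint_op:
  fixes A :: "'a::chilbert_space \<Rightarrow>\<^sub>L 'a"
  assumes A: "A \<in> bounded_ops"
  shows adjoint_op_in_bounded_ops: "adjoint_op A \<in> bounded_ops"
    and cinner_adjoint_left: "cinner (adjoint_op A x) y = cinner x (A y)"
    and norm_adjoint_le: "norm (adjoint_op A) \<le> norm A"
proof -
  obtain B where B: "B \<in> bounded_ops" "norm B \<le> norm A" "\<And>x y. cinner (B x) y = cinner x (A y)"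
    by (rule douglas_factorisation[of id_blinfun A "norm A"])
      (use A in \<open>auto simp: bounded_ops_def norm_blinfun\<close>)
  have "adjoint_op A = B"
    unfolding adjoint_op_def
  proof (rule the_equality)
    show "\<forall>x y. cinner (B x) y = cinner x (A y)"
      using B(3) by blast
    show "B' = B" if "\<forall>x y. cinner (B' x) y = cinner x (A y)" for B' :: "'a \<Rightarrow>\<^sub>L 'a"
      using that by (intro blinfun_eqI cinner_ext) (simp only: B(3))
  qed
  with B show "adjoint_op A \<in> bounded_ops" "cinner (adjoint_op A x) y = cinner x (A y)"
    "norm (adjoint_op A) \<le> norm A" by auto
qed

lemma cinner_adjoint_right:
  assumes "A \<in> bounded_ops"
  shows "cinner x (adjoint_op A y) = cinner (A x) (y :: 'a::chilbert_space)"
  by (metis assms cinner_adjoint_left cinner_commute)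

lemma positive_op_bounded_ops: "positive_op P \<Longrightarrow> P \<in> bounded_ops"
  by (simp add: positive_op_def)

lemma positive_op_inner_nonneg: "positive_op P \<Longrightarrow> inner x (P x) \<ge> 0"
  by (auto simp: positive_op_def complex_nonneg_Reals_iff Re_cinner)

lemma positive_op_cinner:
  assumes "positive_op P"
  shows "cinner x (P x) = complex_of_real (inner x (P x))"
  using assms by (intro complex_eqI) (auto simp: positive_op_def complex_nonneg_Reals_iff Re_cinner)

text \<open>
  Polarisation: the form \<open>\<langle>x, P y\<rangle>\<close> has real diagonal, and evaluating the diagonal at
  \<open>x + y\<close> and at \<open>x + \<i> y\<close> shows that it is Hermitian.
\<close>

lemma positive_op_selfadjoint:
  assumes P: "positive_op P"
  shows "cinner (P x) y = cinner x (P (y :: 'a::complex_inner))"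
proof -
  have real: "Im (cinner z (P z)) = 0" for z
    using positive_op_cinner[OF P, of z] by simp
  note lin = blinfun.add_right cinner_add_left cinner_add_right
    bounded_ops_scaleC[OF positive_op_bounded_ops[OF P]] cinner_scaleC_left cinner_scaleC_right
  have "Im (cinner x (P y)) + Im (cinner y (P x)) = 0"
    using real[of "x + y"] real[of x] real[of y] by (simp add: lin)
  moreover have "Re (cinner x (P y)) - Re (cinner y (P x)) = 0"
    using real[of "x + \<i> *\<^sub>C y"] real[of x] real[of y] by (simp add: lin)
  ultimately have "cinner x (P y) = cnj (cinner y (P x))"
    by (intro complex_eqI) auto
  then show ?thesis by (metis cinner_commute)
qed

lemma positive_op_inner_commute:
  assumes "positive_op P"
  shows "inner (P x) y = inner x (P (y :: 'a::complex_inner))"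
  by (metis assms positive_op_selfadjoint Re_cinner)

lemma positive_opI:
  assumes P: "P \<in> bounded_ops" and sym: "\<And>x y. inner (P x) y = inner x (P y)"
    and pos: "\<And>x. inner x (P x) \<ge> 0"
  shows "positive_op P"
proof -
  have "cinner (P x) x = cinner x (P x)" for x
    by (rule cinner_eq_of_inner_eq[where P = "\<lambda>x. x"]) (auto simp: sym bounded_ops_scaleC P)
  then have "Im (cinner x (P x)) = 0" for x
    by (metis cinner_commute cnj.simps(2) neg_equal_zero)
  then show ?thesis
    using P pos by (auto simp: positive_op_def complex_nonneg_Reals_iff Re_cinner)
qed

lemma positive_op_Cauchy_Schwarz:
  assumes P: "positive_op P"
  shows "(inner y (P x))\<^sup>2 \<le> inner x (P x) * inner y (P (y :: 'a::complex_inner))"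
proof -
  define a b c where "a = inner x (P x)" and "b = inner y (P x)" and "c = inner y (P y)"
  have ge: "0 \<le> a + 2 * t * b + t\<^sup>2 * c" for t
  proof -
    have "inner x (P y) = b"
      unfolding b_def by (metis P positive_op_inner_commute inner_commute)
    moreover have "0 \<le> inner (x + t *\<^sub>R y) (P (x + t *\<^sub>R y))"
      by (rule positive_op_inner_nonneg[OF P])
    ultimately show ?thesis
      by (simp add: blinfun.add_right blinfun.scaleR_right inner_simps a_def b_def c_def power2_eq_square
          algebra_simps)
  qed
  have "b\<^sup>2 \<le> a * c"
  proof (cases "c = 0")
    case True
    have "b = 0"
    proof (rule ccontr)
      assume "b \<noteq> 0"
      then show False
        using ge[of "- (a + 1) / (2 * b)"] True by (simp add: divide_simps)
    qed
    then show ?thesis using True by simp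
  next
    case False
    then have "c > 0"
      using positive_op_inner_nonneg[OF P, of y] by (simp add: c_def)
    moreover have "0 \<le> a - b\<^sup>2 / c"
      using ge[of "- b / c"] False by (simp add: power2_eq_square field_simps)
    ultimately show ?thesis by (simp add: field_simps)
  qed
  then show ?thesis by (simp add: a_def b_def c_def)
qed

lemma positive_op_eq_0:
  assumes P: "positive_op P" and "inner x (P x) = 0"
  shows "P x = (0 :: 'a::complex_inner)"
  using positive_op_Cauchy_Schwarz[OF P, of "P x" x] assms(2) by simp

section \<open>Square roots and polar decomposition\<close>

subclass (in chilbert_space) banach ..

interpretation comp_op: bounded_bilinear "(o\<^sub>L)"
  by (rule bounded_bilinear_blinfun_compose)

lemma blinfun_compose_assoc: "(A o\<^sub>L B) o\<^sub>L C = A o\<^sub>L (B o\<^sub>L C)"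
  by (rule blinfun_eqI) simp

lemma blinfun_compose_id [simp]: "A o\<^sub>L id_blinfun = A" "id_blinfun o\<^sub>L A = A"
  by (rule blinfun_eqI, simp)+

text \<open>
  Complex linearity is commutation with the scalars, which \<open>Y\<close> inherits from \<open>X\<close>.
\<close>

lemma bounded_opsI_commute:
  assumes "\<And>B. B o\<^sub>L X = X o\<^sub>L B \<Longrightarrow> B o\<^sub>L Y = Y o\<^sub>L B"
    and X: "X \<in> bounded_ops"
  shows "Y \<in> bounded_ops"
proof -
  have "Y (c *\<^sub>C x) = c *\<^sub>C Y x" for c x
  proof -
    define B where "B = Blinfun (\<lambda>x :: 'a. c *\<^sub>C x)"
    have B: "B x = c *\<^sub>C x" for x
      unfolding B_def by (simp add: bounded_linear_Blinfun_apply bounded_linear_scaleC)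
    have "B o\<^sub>L X = X o\<^sub>L B"
      by (rule blinfun_eqI) (simp add: B bounded_ops_scaleC[OF X])
    then have "(B o\<^sub>L Y) x = (Y o\<^sub>L B) x"
      using assms(1) by simp
    then show ?thesis by (simp add: B)
  qed
  then show ?thesis by (simp add: bounded_ops_def)
qed

text \<open>
  The fixed point \<open>Y\<close> of \<open>Y \<mapsto> (X + Y\<^sup>2) / 2\<close> satisfies \<open>(1 - Y)\<^sup>2 = 1 - X\<close>, so it
  yields the square root of \<open>1 - X\<close>. Started at 0, the increments of the iteration are
  dominated by those of the scalar iteration \<open>y \<mapsto> (1 + y\<^sup>2) / 2\<close>, which increases
  within \<open>[0, 1]\<close>; hence it converges in norm. Symmetry and commutation relations
  pass to the limit.
\<close>

lemma square_root_iteration_limit: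
  fixes X :: "'a::chilbert_space \<Rightarrow>\<^sub>L 'a"
  assumes X: "norm X \<le> 1" and sym: "\<And>x y. inner (X x) y = inner x (X y)"
  obtains Y where "norm Y \<le> 1" "2 *\<^sub>R Y = X + (Y o\<^sub>L Y)" "\<And>x y. inner (Y x) y = inner x (Y y)"
    "\<And>B. B o\<^sub>L X = X o\<^sub>L B \<Longrightarrow> B o\<^sub>L Y = Y o\<^sub>L B"
proof -
  define F where "F = rec_nat 0 (\<lambda>_ Y. (1/2) *\<^sub>R (X + (Y o\<^sub>L Y)))"
  define f :: "nat \<Rightarrow> real" where "f = rec_nat 0 (\<lambda>_ y. (1 + y\<^sup>2) / 2)"
  have F0: "F 0 = 0" and FS: "\<And>n. F (Suc n) = (1/2) *\<^sub>R (X + (F n o\<^sub>L F n))"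
    by (simp_all add: F_def)
  have f0: "f 0 = 0" and fS: "\<And>n. f (Suc n) = (1 + (f n)\<^sup>2) / 2"
    by (simp_all add: f_def)
  have f_bounds: "0 \<le> f n \<and> f n \<le> 1" for n
  proof (induction n)
    case (Suc n)
    then have "(f n)\<^sup>2 \<le> 1" by (simp add: power_le_one)
    then show ?case by (simp add: fS)
  qed (simp add: f0)
  have F_norm: "norm (F n) \<le> f n" for n
  proof (induction n)
    case (Suc n)
    have "norm (F n o\<^sub>L F n) \<le> norm (F n) * norm (F n)"
      by (rule norm_blinfun_compose)
    also have "\<dots> \<le> (f n)\<^sup>2"
      unfolding power2_eq_square using Suc by (intro mult_mono) (auto simp: f_bounds)
    finally show ?case
      using norm_triangle_ineq[of X "F n o\<^sub>L F n"] X by (simp add: FS fS)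
  qed (simp add: F0 f0)
  have diff: "norm (F (Suc n) - F n) \<le> f (Suc n) - f n" for n
  proof (induction n)
    case 0
    show ?case using X by (simp add: FS F0 fS f0)
  next
    case (Suc n)
    define D where "D = F (Suc n) - F n"
    define d where "d = f (Suc n) - f n"
    have Dd: "norm D \<le> d" "0 \<le> d"
      using Suc norm_ge_zero[of D] unfolding D_def d_def by linarith+
    have "F (Suc (Suc n)) - F (Suc n)
        = (1/2) *\<^sub>R (X + (F (Suc n) o\<^sub>L F (Suc n))) - (1/2) *\<^sub>R (X + (F n o\<^sub>L F n))"
      by (simp only: FS[of "Suc n", symmetric] FS[of n, symmetric])
    also have "\<dots> = (1/2) *\<^sub>R ((D o\<^sub>L F (Suc n)) + (F n o\<^sub>L D))"
      unfolding D_def by (simp add: comp_op.diff_left comp_op.diff_right algebra_simps)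
    also have "norm \<dots> \<le> (norm (D o\<^sub>L F (Suc n)) + norm (F n o\<^sub>L D)) / 2"
      by (simp add: norm_triangle_ineq)
    also have "norm (D o\<^sub>L F (Suc n)) \<le> d * f (Suc n)"
      by (rule order_trans[OF norm_blinfun_compose mult_mono]) (auto simp: Dd F_norm f_bounds)
    also have "norm (F n o\<^sub>L D) \<le> f n * d"
      by (rule order_trans[OF norm_blinfun_compose mult_mono]) (auto simp: Dd F_norm f_bounds)
    also have "(d * f (Suc n) + f n * d) / 2 = f (Suc (Suc n)) - f (Suc n)"
    proof -
      have "f (Suc (Suc n)) - f (Suc n) = ((f (Suc n))\<^sup>2 - (f n)\<^sup>2) / 2"
        using fS[of "Suc n"] fS[of n] by argo
      moreover have "d * f (Suc n) + f n * d = (f (Suc n))\<^sup>2 - (f n)\<^sup>2"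
        by (simp add: d_def power2_eq_square algebra_simps)
      ultimately show ?thesis by simp
    qed
    finally show ?case by simp
  qed
  have "summable (\<lambda>n. F (Suc n) - F n)"
  proof (rule summable_comparison_test'[of _ 0])
    have "incseq f"
      using diff by (intro incseq_SucI) (meson diff_ge_0_iff_ge norm_ge_zero order_trans)
    then obtain l where "f \<longlonglongrightarrow> l"
      using incseq_convergent[of f 1] f_bounds by blast
    then show "summable (\<lambda>n. f (Suc n) - f n)"
      by (rule sums_summable[OF telescope_sums])
  qed (rule diff)
  then have "convergent (\<lambda>n. F 0 + (\<Sum>k<n. F (Suc k) - F k))"
    by (simp add: summable_iff_convergent F0)
  then obtain Y where Y: "F \<longlonglongrightarrow> Y"
    unfolding convergent_def sum_lessThan_telescope by auto
  have app: "(\<lambda>n. F n x) \<longlonglongrightarrow> Y x" for x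
    by (intro tendsto_intros Y)
  have F_sym: "inner (F n x) y = inner x (F n y)" for n x y
  proof (induction n arbitrary: x y)
    case (Suc n)
    then show ?case
      by (simp add: FS sym blinfun.add_left blinfun.scaleR_left inner_add_left inner_add_right)
  qed (simp add: F0)
  have F_comm: "B o\<^sub>L F n = F n o\<^sub>L B" if "B o\<^sub>L X = X o\<^sub>L B" for B n
  proof (induction n)
    case (Suc n)
    have "B o\<^sub>L (F n o\<^sub>L F n) = (F n o\<^sub>L F n) o\<^sub>L B"
      by (metis Suc blinfun_compose_assoc)
    then show ?case
      using that by (simp add: FS comp_op.add_left comp_op.add_right
          comp_op.scaleR_left comp_op.scaleR_right)
  qed (simp add: F0)
  show ?thesis
  proof (rule that)
    show "norm Y \<le> 1"
      using F_norm f_bounds by (intro Lim_bounded[OF tendsto_norm[OF Y]]) (meson order_trans)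
    have "(\<lambda>n. 2 *\<^sub>R F (Suc n)) \<longlonglongrightarrow> 2 *\<^sub>R Y"
      by (intro tendsto_intros LIMSEQ_Suc Y)
    moreover have "(\<lambda>n. 2 *\<^sub>R F (Suc n)) \<longlonglongrightarrow> X + (Y o\<^sub>L Y)"
      unfolding FS by (simp, intro tendsto_intros comp_op.tendsto Y)
    ultimately show "2 *\<^sub>R Y = X + (Y o\<^sub>L Y)"
      by (rule LIMSEQ_unique)
    show "inner (Y x) y = inner x (Y y)" for x y
    proof (rule LIMSEQ_unique)
      show "(\<lambda>n. inner (F n x) y) \<longlonglongrightarrow> inner (Y x) y"
        by (intro tendsto_intros app)
      show "(\<lambda>n. inner (F n x) y) \<longlonglongrightarrow> inner x (Y y)"
        unfolding F_sym by (intro tendsto_intros app)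
    qed
    show "B o\<^sub>L Y = Y o\<^sub>L B" if "B o\<^sub>L X = X o\<^sub>L B" for B
    proof (rule LIMSEQ_unique)
      show "(\<lambda>n. B o\<^sub>L F n) \<longlonglongrightarrow> (B o\<^sub>L Y)"
        by (intro comp_op.tendsto tendsto_intros Y)
      show "(\<lambda>n. B o\<^sub>L F n) \<longlonglongrightarrow> (Y o\<^sub>L B)"
        unfolding F_comm[OF that] by (intro comp_op.tendsto tendsto_intros Y)
    qed
  qed
qed

lemma positive_op_norm_diff_le:
  fixes T :: "'a::complex_inner \<Rightarrow>\<^sub>L 'a"
  assumes T: "positive_op T" and "norm T \<le> 1"
  shows "norm (id_blinfun - T) \<le> 1"
proof (rule norm_blinfun_bound)
  fix x
  have T1: "norm (T y) \<le> norm y" for y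
    using norm_blinfun[of T y] assms(2) mult_right_mono[of "norm T" 1 "norm y"] by simp
  \<comment> \<open>The inequality \<open>T\<^sup>2 \<le> T\<close>, from Cauchy--Schwarz for the form of \<open>T\<close> at \<open>x\<close> and \<open>T x\<close>.\<close>
  have "(norm (T x))\<^sup>2 \<le> inner x (T x)"
  proof (cases "T x = 0")
    case False
    have "(norm (T x))\<^sup>2 * (norm (T x))\<^sup>2 \<le> inner x (T x) * inner (T x) (T (T x))"
      using positive_op_Cauchy_Schwarz[OF T, of "T x" x]
      unfolding power2_norm_eq_inner by (simp only: power2_eq_square)
    also have "\<dots> \<le> inner x (T x) * (norm (T x))\<^sup>2"
    proof (rule mult_left_mono)
      have "inner (T x) (T (T x)) \<le> norm (T x) * norm (T (T x))"
        by (rule norm_cauchy_schwarz)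
      also have "\<dots> \<le> norm (T x) * norm (T x)"
        by (intro mult_left_mono T1) simp
      finally show "inner (T x) (T (T x)) \<le> (norm (T x))\<^sup>2"
        by (simp add: power2_eq_square)
    qed (rule positive_op_inner_nonneg[OF T])
    finally show ?thesis
      by (rule mult_right_le_imp_le) (use False in simp)
  qed simp
  moreover have "(norm (x - T x))\<^sup>2 = (norm x)\<^sup>2 - 2 * inner x (T x) + (norm (T x))\<^sup>2"
    by (simp add: power2_norm_eq_inner inner_diff_left inner_diff_right inner_commute)
  ultimately have "(norm (x - T x))\<^sup>2 \<le> (norm x)\<^sup>2"
    using positive_op_inner_nonneg[OF T, of x] by argo
  then have "norm (x - T x) \<le> norm x"
    by (rule power2_le_imp_le) simp
  then show "norm ((id_blinfun - T) x) \<le> 1 * norm x"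
    by (simp add: blinfun.diff_left)
qed simp

lemma positive_op_scaleR:
  assumes "positive_op T" "r \<ge> 0"
  shows "positive_op (r *\<^sub>R T)"
proof (rule positive_opI)
  show "r *\<^sub>R T \<in> bounded_ops"
    using positive_op_bounded_ops[OF assms(1)]
    by (auto simp: bounded_ops_def blinfun.scaleR_left scaleC.scaleR_right)
qed (use assms in \<open>auto simp: blinfun.scaleR_left positive_op_inner_commute positive_op_inner_nonneg\<close>)

lemma positive_op_square_root:
  fixes T :: "'a::chilbert_space \<Rightarrow>\<^sub>L 'a"
  assumes T: "positive_op T"
  obtains S where "positive_op S" "S o\<^sub>L S = T" "\<And>B. B o\<^sub>L T = T o\<^sub>L B \<Longrightarrow> B o\<^sub>L S = S o\<^sub>L B"
proof -
  define c where "c = norm T + 1"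
  have c: "c > 0" using norm_ge_zero[of T] unfolding c_def by linarith
  define T' where "T' = (1 / c) *\<^sub>R T"
  have T': "positive_op T'"
    unfolding T'_def using c by (intro positive_op_scaleR T) simp
  define X where "X = id_blinfun - T'"
  have "norm T' \<le> 1"
    using c by (simp add: T'_def c_def)
  then have "norm X \<le> 1"
    unfolding X_def by (rule positive_op_norm_diff_le[OF T'])
  moreover have "inner (X x) y = inner x (X y)" for x y
    by (simp add: X_def blinfun.diff_left inner_diff_left inner_diff_right positive_op_inner_commute[OF T'])
  ultimately obtain Y where Y: "norm Y \<le> 1" "2 *\<^sub>R Y = X + (Y o\<^sub>L Y)"
      "\<And>x y. inner (Y x) y = inner x (Y y)"
      "\<And>B. B o\<^sub>L X = X o\<^sub>L B \<Longrightarrow> B o\<^sub>L Y = Y o\<^sub>L B"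
    using square_root_iteration_limit by metis
  define S where "S = sqrt c *\<^sub>R (id_blinfun - Y)"
  have comm: "B o\<^sub>L S = S o\<^sub>L B" if "B o\<^sub>L T = T o\<^sub>L B" for B
  proof -
    have "B o\<^sub>L X = X o\<^sub>L B"
      using that by (simp add: X_def T'_def comp_op.diff_left comp_op.diff_right
          comp_op.scaleR_left comp_op.scaleR_right)
    then have "B o\<^sub>L Y = Y o\<^sub>L B" by (rule Y(4))
    then show ?thesis
      by (simp add: S_def comp_op.diff_left comp_op.diff_right
          comp_op.scaleR_left comp_op.scaleR_right)
  qed
  have "positive_op S"
  proof (rule positive_opI)
    show "S \<in> bounded_ops"
      using comm positive_op_bounded_ops[OF T] by (rule bounded_opsI_commute)
    show "inner (S x) y = inner x (S y)" for x y
      by (simp add: S_def blinfun.diff_left blinfun.scaleR_left inner_diff_left inner_diff_right Y(3))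
    show "inner x (S x) \<ge> 0" for x
    proof -
      have "inner x (Y x) \<le> norm x * norm (Y x)"
        by (rule norm_cauchy_schwarz)
      also have "\<dots> \<le> norm x * (1 * norm x)"
        using norm_blinfun[of Y x] mult_right_mono[OF Y(1), of "norm x"]
        by (intro mult_left_mono) auto
      finally show ?thesis
        using c by (simp add: S_def blinfun.diff_left blinfun.scaleR_left inner_diff_right
            norm_eq_sqrt_inner)
    qed
  qed
  moreover have "S o\<^sub>L S = T"
  proof -
    have "S o\<^sub>L S = c *\<^sub>R ((id_blinfun - Y) o\<^sub>L (id_blinfun - Y))"
      unfolding S_def comp_op.scaleR_left comp_op.scaleR_right using c by simp
    also have "(id_blinfun - Y) o\<^sub>L (id_blinfun - Y) = id_blinfun - 2 *\<^sub>R Y + (Y o\<^sub>L Y)"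
      by (simp add: comp_op.diff_left comp_op.diff_right scaleR_2)
    also have "c *\<^sub>R \<dots> = T"
      using c by (simp add: Y(2) X_def T'_def)
    finally show ?thesis .
  qed
  ultimately show ?thesis using comm that by blast
qed

text \<open>
  Any positive root \<open>R\<close> of \<open>T\<close> commutes with \<open>T\<close>, hence with the root \<open>S\<close> built above, so
  \<open>(R + S) (R - S) = 0\<close>. Thus \<open>y = (R - S) x\<close> satisfies \<open>\<langle>y, R y\<rangle> + \<langle>y, S y\<rangle> = 0\<close>, which
  forces \<open>R y = S y = 0\<close>, and \<open>(norm y)\<^sup>2 = \<langle>x, (R - S) y\<rangle>\<close> vanishes.
\<close>

lemma positive_op_square_root_unique:
  fixes T :: "'a::chilbert_space \<Rightarrow>\<^sub>L 'a"
  assumes P: "positive_op P" "P o\<^sub>L P = T" and Q: "positive_op Q" "Q o\<^sub>L Q = T"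
  shows "P = Q"
proof -
  have T: "positive_op T"
  proof (rule positive_opI)
    show "T \<in> bounded_ops"
      using positive_op_bounded_ops[OF P(1)] unfolding P(2)[symmetric] by (auto simp: bounded_ops_def)
    show "inner (T x) y = inner x (T y)" for x y
      unfolding P(2)[symmetric] by (simp add: positive_op_inner_commute[OF P(1)])
    show "inner x (T x) \<ge> 0" for x
      unfolding P(2)[symmetric] using positive_op_inner_commute[OF P(1), of x "P x", symmetric] by simp
  qed
  obtain S where S: "positive_op S" "S o\<^sub>L S = T" "\<And>B. B o\<^sub>L T = T o\<^sub>L B \<Longrightarrow> B o\<^sub>L S = S o\<^sub>L B"
    using positive_op_square_root[OF T] by metis
  have root_eq: "R = S" if R: "positive_op R" "R o\<^sub>L R = T" for R
  proof (rule blinfun_eqI)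
    fix x
    have "R o\<^sub>L S = S o\<^sub>L R"
      using R(2) by (intro S(3)) (metis blinfun_compose_assoc)
    then have comm: "R (S v) = S (R v)" for v
      by (metis blinfun_apply_blinfun_compose)
    have sq: "R (R v) = S (S v)" for v
      by (metis R(2) S(2) blinfun_apply_blinfun_compose)
    define y where "y = R x - S x"
    have "R y + S y = 0"
      by (simp add: y_def blinfun.diff_right comm sq)
    then have "inner y (R y) + inner y (S y) = 0"
      by (metis inner_add_right inner_zero_right)
    then have "inner y (R y) = 0" "inner y (S y) = 0"
      using positive_op_inner_nonneg[OF R(1), of y] positive_op_inner_nonneg[OF S(1), of y] by linarith+
    then have 0: "R y = 0" "S y = 0"
      using positive_op_eq_0 R(1) S(1) by blast+
    have "inner y y = inner x (R y) - inner x (S y)"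
      by (subst (1) y_def) (simp add: inner_diff_left positive_op_inner_commute R(1) S(1))
    then have "y = 0" using 0 by simp
    then show "R x = S x" by (simp add: y_def)
  qed
  show ?thesis using root_eq P Q by metis
qed

lemma bounded_ops_compose:
  "A \<in> bounded_ops \<Longrightarrow> B \<in> bounded_ops \<Longrightarrow> A o\<^sub>L B \<in> bounded_ops"
  by (auto simp: bounded_ops_def)

lemma abs_op:
  fixes A :: "'a::chilbert_space \<Rightarrow>\<^sub>L 'a"
  assumes A: "A \<in> bounded_ops"
  shows positive_abs_op: "positive_op (abs_op A)"
    and abs_op_square: "abs_op A o\<^sub>L abs_op A = adjoint_op A o\<^sub>L A"
proof -
  have "positive_op (adjoint_op A o\<^sub>L A)"
  proof (rule positive_opI)
    show "adjoint_op A o\<^sub>L A \<in> bounded_ops"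
      by (intro bounded_ops_compose adjoint_op_in_bounded_ops A)
  qed (simp_all add: Re_cinner[symmetric] cinner_adjoint_left[OF A] cinner_adjoint_right[OF A] cinner_self)
  then obtain S where S: "positive_op S" "S o\<^sub>L S = adjoint_op A o\<^sub>L A"
    using positive_op_square_root by metis
  then have "abs_op A = S"
    unfolding abs_op_def by (intro the_equality) (auto intro: positive_op_square_root_unique)
  with S show "positive_op (abs_op A)" "abs_op A o\<^sub>L abs_op A = adjoint_op A o\<^sub>L A" by auto
qed

lemma norm_abs_op_apply:
  assumes A: "A \<in> bounded_ops"
  shows "norm (abs_op A x) = norm (A (x :: 'a::chilbert_space))"
proof -
  have "cinner (abs_op A x) (abs_op A x) = cinner x ((abs_op A o\<^sub>L abs_op A) x)"
    by (simp add: positive_op_selfadjoint[OF positive_abs_op[OF A]])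
  also have "\<dots> = cinner (A x) (A x)"
    by (simp add: abs_op_square[OF A] cinner_adjoint_right[OF A])
  finally show ?thesis
    by (simp add: cinner_self del: of_real_power)
qed

text \<open>
  As \<open>A\<close> and \<open>abs_op A\<close> have the same norm on every vector, Douglas' lemma provides the adjoint
  \<open>V\<close> of the polar factor. Its values lie in the closure of the range of \<open>abs_op A\<close>, so
  the identity \<open>V A = \<bar>A\<bar>\<close> may be tested against that range.
\<close>

lemma polar_decomposition:
  fixes A :: "'a::chilbert_space \<Rightarrow>\<^sub>L 'a"
  assumes A: "A \<in> bounded_ops"
  obtains U where "U \<in> bounded_ops" "norm U \<le> 1" "A = U o\<^sub>L abs_op A" "adjoint_op U o\<^sub>L A = abs_op A"
proof -
  define P where "P = abs_op A"
  have P: "P \<in> bounded_ops"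
    unfolding P_def by (intro positive_op_bounded_ops positive_abs_op A)
  obtain V where V: "V \<in> bounded_ops" "norm V \<le> 1" "\<And>x y. cinner (V y) (P x) = cinner y (A x)"
    "\<And>y. V y \<in> closure (range P)"
    by (rule douglas_factorisation[OF P A, of 1]) (auto simp: P_def norm_abs_op_apply A)
  define U where "U = adjoint_op V"
  have U: "U \<in> bounded_ops" "norm U \<le> 1"
    using V(1,2) norm_adjoint_le[OF V(1)] by (auto simp: U_def adjoint_op_in_bounded_ops)
  have "A = U o\<^sub>L P"
  proof (intro blinfun_eqI cinner_ext)
    show "cinner (A x) y = cinner ((U o\<^sub>L P) x) y" for x y
      using V(3)[of y x] by (metis U_def V(1) blinfun_apply_blinfun_compose cinner_adjoint_left cinner_commute)
  qed
  moreover have "adjoint_op U o\<^sub>L A = P"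
  proof -
    have "V y = adjoint_op U y" for y
    proof (rule cinner_ext)
      show "cinner (V y) z = cinner (adjoint_op U y) z" for z
        unfolding cinner_adjoint_left[OF U(1)] unfolding U_def cinner_adjoint_right[OF V(1)] ..
    qed
    moreover have "V (A y) = P y" for y
    proof (rule closure_range_orthogonal_unique[OF V(4)])
      show "P y \<in> closure (range P)"
        by (rule subsetD[OF closure_subset]) simp
      have "cinner (P y) (P x) = cinner y ((P o\<^sub>L P) x)" for x
        using positive_op_selfadjoint[OF positive_abs_op[OF A]] by (simp add: P_def)
      then have "cinner (P y) (P x) = cinner (A y) (A x)" for x
        by (simp add: abs_op_square[OF A] P_def cinner_adjoint_right[OF A])
      then show "inner (V (A y)) (P x) = inner (P y) (P x)" for x
        by (simp add: Re_cinner[symmetric] V(3))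
    qed
    ultimately show ?thesis
      by (intro blinfun_eqI) simp
  qed
  ultimately show ?thesis
    using that U unfolding P_def by blast
qed

section \<open>Orthonormal bases\<close>

definition orthonormal :: "'a::complex_inner set \<Rightarrow> bool" where
  "orthonormal F \<longleftrightarrow> (\<forall>e\<in>F. norm e = 1) \<and> (\<forall>e\<in>F. \<forall>f\<in>F. e \<noteq> f \<longrightarrow> cinner e f = 0)"

lemma orthonormal_subset: "orthonormal E \<Longrightarrow> F \<subseteq> E \<Longrightarrow> orthonormal F"
  by (auto simp: orthonormal_def)

lemma is_onb_orthonormal: "is_onb E \<Longrightarrow> orthonormal E"
  by (simp add: orthonormal_def is_onb_def)

lemma orthonormal_cinner:
  "orthonormal F \<Longrightarrow> e \<in> F \<Longrightarrow> f \<in> F \<Longrightarrow> cinner e f = (if e = f then 1 else 0)"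
  by (auto simp: orthonormal_def cinner_self)

definition orthogonal_projection :: "'a::complex_inner set \<Rightarrow> 'a \<Rightarrow> 'a" where
  "orthogonal_projection F x = (\<Sum>e\<in>F. cinner e x *\<^sub>C e)"

lemma cinner_orthogonal_projection:
  assumes "finite F" "orthonormal F" "e \<in> F"
  shows "cinner e (orthogonal_projection F x) = cinner e x"
proof -
  have "cinner e (orthogonal_projection F x) = (\<Sum>f\<in>F. cinner f x * cinner e f)"
    by (simp add: orthogonal_projection_def cinner.sum_right cinner_scaleC_right)
  also have "\<dots> = (\<Sum>f\<in>F. if e = f then cinner f x else 0)"
    by (intro sum.cong refl) (simp add: orthonormal_cinner[OF assms(2,3)])
  finally show ?thesis using assms by simp
qed

lemma orthogonal_projection_defect:
  assumes "finite F" "orthonormal F"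
  shows "(norm (x - orthogonal_projection F x))\<^sup>2 = (norm x)\<^sup>2 - (\<Sum>e\<in>F. (cmod (cinner e x))\<^sup>2)"
proof -
  define p where "p = orthogonal_projection F x"
  have p: "cinner p y = (\<Sum>e\<in>F. cnj (cinner e x) * cinner e y)" for y
    by (simp add: p_def orthogonal_projection_def cinner.sum_left cinner_scaleC_left)
  have "cinner p x = complex_of_real (\<Sum>e\<in>F. (cmod (cinner e x))\<^sup>2)"
    unfolding p of_real_sum by (intro sum.cong refl) (metis complex_norm_square mult.commute)
  then have px: "inner p x = (\<Sum>e\<in>F. (cmod (cinner e x))\<^sup>2)"
    by (metis Re_cinner Re_complex_of_real)
  have "cinner p p = cinner p x"
    unfolding p by (intro sum.cong refl) (simp add: cinner_orthogonal_projection assms p_def)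
  then have "inner p p = inner p x"
    by (metis Re_cinner)
  then show ?thesis
    unfolding p_def[symmetric] px[symmetric]
    by (simp add: power2_norm_eq_inner inner_diff_left inner_diff_right inner_commute)
qed

lemma bessel_inequality:
  assumes "finite F" "orthonormal F"
  shows "(\<Sum>e\<in>F. (cmod (cinner e x))\<^sup>2) \<le> (norm x)\<^sup>2"
  using orthogonal_projection_defect[OF assms, of x] zero_le_power2[of "norm (x - orthogonal_projection F x)"]
  by linarith

text \<open>
  The projection onto the span of a finite part of the basis is the best approximation
  from that span, and \<open>x\<close> is a limit of finite combinations of basis vectors.
\<close>

lemma parseval:
  assumes E: "is_onb E"
  shows "((\<lambda>e. (cmod (cinner e x))\<^sup>2) has_sum (norm x)\<^sup>2) E"
proof -
  define g where "g e = (cmod (cinner e x))\<^sup>2" for e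
  have on: "orthonormal F" if "F \<subseteq> E" for F
    using is_onb_orthonormal[OF E] that by (rule orthonormal_subset)
  have le: "sum g F \<le> (norm x)\<^sup>2" if "finite F" "F \<subseteq> E" for F
    unfolding g_def using bessel_inequality that on by blast
  have sm: "g summable_on E"
    by (rule nonneg_bdd_above_summable_on)
      (auto simp: g_def[abs_def] intro!: bdd_aboveI[of _ "(norm x)\<^sup>2"] le[unfolded g_def[abs_def]])
  have "(norm x)\<^sup>2 \<le> infsum g E"
  proof (rule field_le_epsilon)
    fix d :: real assume d: "d > 0"
    have "x \<in> closure (cspan E)"
      using E by (simp add: is_onb_def)
    then obtain y where y: "y \<in> cspan E" "dist y x < sqrt d"
      unfolding closure_approachable using d by (metis real_sqrt_gt_zero)
    then obtain F r where F: "finite F" "F \<subseteq> E" and y_eq: "y = (\<Sum>a\<in>F. r a *\<^sub>C a)"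
      unfolding complex_vector.span_explicit by blast
    define p where "p = orthogonal_projection F x"
    have orth: "cinner (x - p) e = 0" if "e \<in> F" for e
    proof -
      have "cinner e (x - p) = 0"
        using F on that by (simp add: p_def cinner.diff_right cinner_orthogonal_projection)
      then show ?thesis by (metis cinner_commute complex_cnj_zero)
    qed
    have "cinner (x - p) p = 0" "cinner (x - p) y = 0"
      by (simp_all add: p_def[unfolded orthogonal_projection_def] y_eq cinner.sum_right cinner_scaleC_right
          orth[unfolded p_def[unfolded orthogonal_projection_def]])
    then have "inner (x - p) p = 0" "inner (x - p) y = 0"
      by (metis Re_cinner zero_complex.sel(1))+
    then have "(norm (x - p))\<^sup>2 = inner (x - p) (x - y)"
      by (simp add: power2_norm_eq_inner inner_diff_right)
    also have "\<dots> \<le> norm (x - p) * norm (x - y)"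
      by (rule norm_cauchy_schwarz)
    finally have "norm (x - p) \<le> norm (x - y)"
      by (cases "x = p") (simp_all add: power2_eq_square)
    then have "(norm (x - p))\<^sup>2 \<le> (sqrt d)\<^sup>2"
      using y(2) by (intro power_mono) (simp_all add: dist_norm norm_minus_commute)
    then have "(norm x)\<^sup>2 - sum g F \<le> d"
      using orthogonal_projection_defect[OF F(1) on[OF F(2)], of x] d by (simp add: p_def g_def[abs_def])
    moreover have "sum g F \<le> infsum g E"
      by (rule finite_sum_le_infsum[OF sm F]) (simp add: g_def)
    ultimately show "(norm x)\<^sup>2 \<le> infsum g E + d" by linarith
  qed
  moreover have "infsum g E \<le> (norm x)\<^sup>2"
    by (rule infsum_le_finite_sums[OF sm le])
  ultimately show ?thesis
    using has_sum_infsum[OF sm] by (simp add: g_def[abs_def])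
qed

text \<open>
  A maximal orthonormal set spans a dense subspace: otherwise the normalised
  difference of a vector outside the closure and its projection could be added.
\<close>

lemma onb_exists: "\<exists>E :: 'a::chilbert_space set. is_onb E"
proof -
  have "\<exists>M\<in>{F :: 'a set. orthonormal F}. \<forall>X\<in>{F. orthonormal F}. M \<subseteq> X \<longrightarrow> X = M"
  proof (rule subset_Zorn')
    fix C :: "'a set set" assume C: "subset.chain {F. orthonormal F} C"
    have "e = f \<or> cinner e f = 0" if "e \<in> X" "f \<in> Y" "X \<in> C" "Y \<in> C" for e f X Y
    proof -
      have "X \<subseteq> Y \<or> Y \<subseteq> X" "orthonormal X" "orthonormal Y"
        using C that unfolding subset_chain_def by auto
      then show ?thesis using that(1,2) unfolding orthonormal_def by blast
    qed
    moreover have "norm e = 1" if "e \<in> X" "X \<in> C" for e X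
      using C that unfolding subset_chain_def orthonormal_def by auto
    ultimately show "\<Union>C \<in> {F. orthonormal F}"
      unfolding orthonormal_def by blast
  qed
  then obtain M :: "'a set" where M: "orthonormal M" and max: "\<And>X. orthonormal X \<Longrightarrow> M \<subseteq> X \<Longrightarrow> X = M"
    by blast
  have "u \<in> closure (cspan M)" for u
  proof (rule ccontr)
    assume u: "u \<notin> closure (cspan M)"
    have "subspace (cspan M)"
      by (auto intro!: subspaceI complex_vector.span_zero complex_vector.span_add complex_vector.span_scale
          simp: scaleC_of_real[symmetric])
    then obtain z where z: "z \<in> closure (cspan M)" "\<And>x. x \<in> cspan M \<Longrightarrow> inner z x = inner u x"
      using riesz_representation_range[of "cspan M" "\<lambda>x. x" "\<lambda>x. inner u x" "norm u"]
      by (auto simp: Cauchy_Schwarz_ineq2 linear_iff inner_add_right)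
    define r where "r = u - z"
    have r: "r \<noteq> 0" using u z(1) by (auto simp: r_def)
    have orth: "cinner r e = 0" if e: "e \<in> M" for e
    proof -
      have "inner r e = 0" "inner r (\<i> *\<^sub>C e) = 0"
        using z(2) e by (simp_all add: r_def inner_diff_left complex_vector.span_base complex_vector.span_scale)
      then show ?thesis
        by (intro complex_eqI) (simp_all add: Re_cinner Im_cinner)
    qed
    define w where "w = (1 / norm r) *\<^sub>R r"
    have w: "norm w = 1" using r by (simp add: w_def)
    have we: "cinner w e = 0" if "e \<in> M" for e
      using orth[OF that] by (simp add: w_def cinner.scaleR_left)
    then have ew: "cinner e w = 0" if "e \<in> M" for e
      using that by (metis cinner_commute complex_cnj_zero)
    have "orthonormal (insert w M)"
      using M w we ew unfolding orthonormal_def by auto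
    then have "insert w M = M" by (rule max) auto
    then have "w \<in> M" by blast
    then have "cinner w w = 0" by (rule we)
    then show False using w by (simp add: cinner_self)
  qed
  then have "is_onb M"
    using M by (auto simp: is_onb_def orthonormal_def)
  then show ?thesis ..
qed

lemma is_onb_some_onb: "is_onb some_onb"
  unfolding some_onb_def by (rule someI_ex[OF onb_exists])

lemma cspan_finite_onb:
  assumes E: "is_onb E" and fin: "finite E"
  shows "cspan E = UNIV"
proof -
  have "x \<in> cspan E" for x
  proof -
    have "(norm x)\<^sup>2 = (\<Sum>e\<in>E. (cmod (cinner e x))\<^sup>2)"
      using has_sum_unique[OF parseval[OF E] has_sum_finite[OF fin]] .
    then have "x = orthogonal_projection E x"
      using orthogonal_projection_defect[OF fin is_onb_orthonormal[OF E], of x] by simp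
    also have "\<dots> \<in> cspan E"
      unfolding orthogonal_projection_def
      by (intro complex_vector.span_sum complex_vector.span_scale complex_vector.span_base)
    finally show ?thesis .
  qed
  then show ?thesis by blast
qed

section \<open>The trace class\<close>

text \<open>
  One half of the basis independence of the Hilbert--Schmidt norm: expand each \<open>G f\<close> along
  \<open>E\<close> by Parseval, exchange the sums, and apply Bessel to \<open>G' e\<close>.
\<close>

lemma hilbert_schmidt_sum_le_adjoint:
  assumes F: "finite F" "orthonormal F" and E: "is_onb E"
    and adj: "\<And>e f. cinner e (G f) = cinner (G' e) f"
    and sm: "(\<lambda>e. (norm (G' e))\<^sup>2) summable_on E"
  shows "(\<Sum>f\<in>F. (norm (G f))\<^sup>2) \<le> (\<Sum>\<^sub>\<infinity>e\<in>E. (norm (G' e))\<^sup>2)"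
proof (rule has_sum_mono)
  show "((\<lambda>e. \<Sum>f\<in>F. (cmod (cinner e (G f)))\<^sup>2) has_sum (\<Sum>f\<in>F. (norm (G f))\<^sup>2)) E"
    using F(1) by (induction F rule: finite_induct) (auto intro!: has_sum_add parseval E)
  show "((\<lambda>e. (norm (G' e))\<^sup>2) has_sum (\<Sum>\<^sub>\<infinity>e\<in>E. (norm (G' e))\<^sup>2)) E"
    by (rule has_sum_infsum[OF sm])
  show "(\<Sum>f\<in>F. (cmod (cinner e (G f)))\<^sup>2) \<le> (norm (G' e))\<^sup>2" for e
  proof -
    have "cmod (cinner e (G f)) = cmod (cinner f (G' e))" for f
      unfolding adj by (metis cinner_commute complex_mod_cnj)
    then show ?thesis using bessel_inequality[OF F, of "G' e"] by simp
  qed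
qed

text \<open>
  \<open>trace_bounded A C\<close> says that the trace norm of \<open>A\<close> is at most \<open>C\<close> without mentioning
  the absolute value: it is the duality \<open>\<parallel>A\<parallel>\<^sub>1 = sup \<bar>tr (W\<^sup>* A)\<bar>\<close> over contractions \<open>W\<close>,
  where the moduli inside the sum cost nothing because phases can be absorbed into \<open>W\<close>.
  In this form the triangle inequality and the independence of the basis are evident.
\<close>

definition trace_bounded :: "('a::complex_inner \<Rightarrow>\<^sub>L 'a) \<Rightarrow> real \<Rightarrow> bool" where
  "trace_bounded A C \<longleftrightarrow> (\<forall>W. W \<in> bounded_ops \<longrightarrow> norm W \<le> 1 \<longrightarrow>
     (\<forall>F. finite F \<and> orthonormal F \<longrightarrow> (\<Sum>e\<in>F. cmod (cinner (blinfun_apply W e) (A e))) \<le> C))"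

lemma trace_boundedD:
  "trace_bounded A C \<Longrightarrow> W \<in> bounded_ops \<Longrightarrow> norm W \<le> 1 \<Longrightarrow> finite F \<Longrightarrow> orthonormal F
    \<Longrightarrow> (\<Sum>e\<in>F. cmod (cinner (blinfun_apply W e) (A e))) \<le> C"
  by (simp add: trace_bounded_def)

lemma trace_bounded_sum_diagonal:
  assumes "trace_bounded A C" "finite F" "orthonormal F"
  shows "(\<Sum>e\<in>F. cmod (cinner e (A e))) \<le> C"
  using trace_boundedD[OF assms(1), of id_blinfun F] assms(2,3)
  by (simp add: bounded_ops_def norm_blinfun_id_le)

lemma trace_bounded_add:
  assumes "trace_bounded A C" "trace_bounded B D"
  shows "trace_bounded (A + B) (C + D)"
  unfolding trace_bounded_def
proof (intro allI impI, elim conjE)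
  fix W :: "'a \<Rightarrow>\<^sub>L 'a" and F :: "'a set"
  assume W: "W \<in> bounded_ops" "norm W \<le> 1" and F: "finite F" "orthonormal F"
  have "(\<Sum>e\<in>F. cmod (cinner (W e) ((A + B) e)))
      \<le> (\<Sum>e\<in>F. cmod (cinner (W e) (A e)) + cmod (cinner (W e) (B e)))"
    by (intro sum_mono) (simp add: blinfun.add_left cinner.add_right norm_triangle_ineq)
  also have "\<dots> \<le> C + D"
    unfolding sum.distrib by (intro add_mono trace_boundedD[OF assms(1)] trace_boundedD[OF assms(2)] W F)
  finally show "(\<Sum>e\<in>F. cmod (cinner (W e) ((A + B) e))) \<le> C + D" .
qed

lemma trace_bounded_scaleC_op:
  assumes "trace_bounded A C"
  shows "trace_bounded (scaleC_op c A) (cmod c * C)"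
  unfolding trace_bounded_def
proof (intro allI impI, elim conjE)
  fix W :: "'a \<Rightarrow>\<^sub>L 'a" and F :: "'a set"
  assume W: "W \<in> bounded_ops" "norm W \<le> 1" and F: "finite F" "orthonormal F"
  have "(\<Sum>e\<in>F. cmod (cinner (W e) (scaleC_op c A e))) = cmod c * (\<Sum>e\<in>F. cmod (cinner (W e) (A e)))"
    by (simp add: scaleC_op.rep_eq cinner_scaleC_right norm_mult sum_distrib_left)
  also have "\<dots> \<le> cmod c * C"
    by (intro mult_left_mono trace_boundedD[OF assms] W F) simp
  finally show "(\<Sum>e\<in>F. cmod (cinner (W e) (scaleC_op c A e))) \<le> cmod c * C" .
qed

text \<open>
  With \<open>A = U P\<close> polar and \<open>S\<close> the root of \<open>P\<close>, each term is
  \<open>\<langle>W e, A e\<rangle> = \<langle>(S U\<^sup>* W) e, S e\<rangle>\<close>, so by the inequality of arithmetic and geometric means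
  the sum is controlled by the Hilbert--Schmidt sums of \<open>S U\<^sup>* W\<close> and of \<open>S\<close>. Both are at
  most that of \<open>S\<close> over \<open>E\<close>, which is the trace of \<open>P\<close>.
\<close>

lemma trace_bounded_of_summable_abs:
  fixes A :: "'a::chilbert_space \<Rightarrow>\<^sub>L 'a"
  assumes A: "A \<in> bounded_ops" and E: "is_onb E"
    and sm: "(\<lambda>e. inner e (abs_op A e)) summable_on E"
  shows "trace_bounded A (\<Sum>\<^sub>\<infinity>e\<in>E. inner e (abs_op A e))"
  unfolding trace_bounded_def
proof (intro allI impI, elim conjE)
  fix W :: "'a \<Rightarrow>\<^sub>L 'a" and F :: "'a set"
  assume W: "W \<in> bounded_ops" "norm W \<le> 1" and F: "finite F" "orthonormal F"
  define \<tau> where "\<tau> = (\<Sum>\<^sub>\<infinity>e\<in>E. inner e (abs_op A e))"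
  obtain U where U: "U \<in> bounded_ops" "norm U \<le> 1" "A = U o\<^sub>L abs_op A"
    using polar_decomposition[OF A] by metis
  obtain S where S: "positive_op S" "S o\<^sub>L S = abs_op A"
    using positive_op_square_root[OF positive_abs_op[OF A]] by metis
  have S_norm: "(norm (S e))\<^sup>2 = inner e (abs_op A e)" for e
    unfolding S(2)[symmetric] power2_norm_eq_inner by (simp add: positive_op_inner_commute[OF S(1)])
  have contr: "norm (B x) \<le> norm x" if "norm B \<le> 1" for B :: "'a \<Rightarrow>\<^sub>L 'a" and x
    using norm_blinfun[of B x] that mult_right_mono[of "norm B" 1 "norm x"] by simp
  define G where "G e = S (adjoint_op U (W e))" for e
  define G' where "G' e = adjoint_op W (U (S e))" for e
  have adj: "cinner e (G f) = cinner (G' e) f" for e f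
    by (simp add: G_def G'_def positive_op_selfadjoint[OF S(1), symmetric] cinner_adjoint_right[OF U(1)]
        cinner_adjoint_left[OF W(1)])
  have G'_le: "(norm (G' e))\<^sup>2 \<le> inner e (abs_op A e)" for e
  proof -
    have "norm (G' e) \<le> norm (S e)"
      unfolding G'_def
      by (meson contr U(2) W norm_adjoint_le order_trans)
    then show ?thesis unfolding S_norm[symmetric] by (simp add: power_mono)
  qed
  have smG': "(\<lambda>e. (norm (G' e))\<^sup>2) summable_on E"
    by (rule summable_on_comparison_test[OF sm]) (auto simp: G'_le)
  have "(\<Sum>f\<in>F. (norm (G f))\<^sup>2) \<le> (\<Sum>\<^sub>\<infinity>e\<in>E. (norm (G' e))\<^sup>2)"
    by (rule hilbert_schmidt_sum_le_adjoint[OF F E adj smG'])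
  also have "\<dots> \<le> \<tau>"
    unfolding \<tau>_def by (rule infsum_mono[OF smG' sm G'_le])
  finally have sumG: "(\<Sum>f\<in>F. (norm (G f))\<^sup>2) \<le> \<tau>" .
  have sumS: "(\<Sum>f\<in>F. (norm (S f))\<^sup>2) \<le> \<tau>"
    using hilbert_schmidt_sum_le_adjoint[OF F E, of S S] sm
    by (simp add: S_norm \<tau>_def positive_op_selfadjoint[OF S(1)])
  have "cmod (cinner (W e) (A e)) \<le> ((norm (G e))\<^sup>2 + (norm (S e))\<^sup>2) / 2" for e
  proof -
    have "cinner (W e) (A e) = cinner (W e) (U ((S o\<^sub>L S) e))"
      unfolding S(2) using U(3) by (metis blinfun_apply_blinfun_compose)
    also have "\<dots> = cinner (G e) (S e)"
      by (simp add: G_def positive_op_selfadjoint[OF S(1)] cinner_adjoint_left[OF U(1)])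
    finally have "cmod (cinner (W e) (A e)) \<le> norm (G e) * norm (S e)"
      by (simp add: cmod_cinner_le)
    also have "\<dots> \<le> ((norm (G e))\<^sup>2 + (norm (S e))\<^sup>2) / 2"
      using sum_squares_bound[of "norm (G e)" "norm (S e)"] by simp
    finally show ?thesis .
  qed
  then have "(\<Sum>e\<in>F. cmod (cinner (W e) (A e))) \<le> (\<Sum>e\<in>F. ((norm (G e))\<^sup>2 + (norm (S e))\<^sup>2) / 2)"
    by (rule sum_mono)
  also have "\<dots> = ((\<Sum>e\<in>F. (norm (G e))\<^sup>2) + (\<Sum>e\<in>F. (norm (S e))\<^sup>2)) / 2"
    by (simp add: sum_divide_distrib[symmetric] sum.distrib)
  also have "\<dots> \<le> \<tau>" using sumG sumS by simp
  finally show "(\<Sum>e\<in>F. cmod (cinner (W e) (A e))) \<le> (\<Sum>\<^sub>\<infinity>e\<in>E. inner e (abs_op A e))"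
    by (simp add: \<tau>_def)
qed

text \<open>Conversely, taking for \<open>W\<close> the polar factor \<open>U\<close> turns the sums into partial traces of \<open>U\<^sup>* A = \<bar>A\<bar>\<close>.\<close>

lemma trace_bounded_abs:
  fixes A :: "'a::chilbert_space \<Rightarrow>\<^sub>L 'a"
  assumes A: "A \<in> bounded_ops" and E: "is_onb E" and bd: "trace_bounded A C"
  shows trace_bounded_summable_abs: "(\<lambda>e. inner e (abs_op A e)) summable_on E"
    and trace_bounded_infsum_abs: "(\<Sum>\<^sub>\<infinity>e\<in>E. inner e (abs_op A e)) \<le> C"
proof -
  obtain U where U: "U \<in> bounded_ops" "norm U \<le> 1" "adjoint_op U o\<^sub>L A = abs_op A"
    using polar_decomposition[OF A] by metis
  have le: "(\<Sum>e\<in>F. inner e (abs_op A e)) \<le> C" if F: "finite F" "F \<subseteq> E" for F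
  proof -
    have "inner e (abs_op A e) \<le> cmod (cinner (U e) (A e))" for e
    proof -
      have "cinner e (abs_op A e) = cinner (U e) (A e)"
        unfolding U(3)[symmetric] by (simp add: cinner_adjoint_right[OF U(1)])
      then show ?thesis by (metis Re_cinner complex_Re_le_cmod)
    qed
    then have "(\<Sum>e\<in>F. inner e (abs_op A e)) \<le> (\<Sum>e\<in>F. cmod (cinner (U e) (A e)))"
      by (rule sum_mono)
    also have "\<dots> \<le> C"
      using F orthonormal_subset[OF is_onb_orthonormal[OF E]] by (intro trace_boundedD[OF bd] U) auto
    finally show ?thesis .
  qed
  show sm: "(\<lambda>e. inner e (abs_op A e)) summable_on E"
    by (rule nonneg_bdd_above_summable_on)
      (auto intro!: bdd_aboveI[of _ C] le positive_op_inner_nonneg positive_abs_op A)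
  show "(\<Sum>\<^sub>\<infinity>e\<in>E. inner e (abs_op A e)) \<le> C"
    by (rule infsum_le_finite_sums[OF sm le])
qed

lemma summable_on_cinner_positive_iff:
  assumes "positive_op P"
  shows "(\<lambda>e. cinner e (P e)) summable_on E \<longleftrightarrow> (\<lambda>e. inner e (P e)) summable_on E"
proof
  assume "(\<lambda>e. cinner e (P e)) summable_on E"
  then have "(\<lambda>e. Re (cinner e (P e))) summable_on E" by (rule summable_on_Re)
  then show "(\<lambda>e. inner e (P e)) summable_on E" by (simp add: Re_cinner)
next
  assume "(\<lambda>e. inner e (P e)) summable_on E"
  then show "(\<lambda>e. cinner e (P e)) summable_on E"
    unfolding positive_op_cinner[OF assms] by (rule summable_on_of_real)
qed

lemma trace_class_iff: "A \<in> trace_class \<longleftrightarrow> A \<in> bounded_ops \<and> (\<exists>C. trace_bounded A C)"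
proof (intro iffI conjI; (elim conjE exE)?)
  assume "A \<in> trace_class"
  then obtain E where A: "A \<in> bounded_ops" and E: "is_onb E"
      and "(\<lambda>e. cinner e (abs_op A e)) summable_on E"
    unfolding trace_class_def by blast
  then have "(\<lambda>e. inner e (abs_op A e)) summable_on E"
    using summable_on_cinner_positive_iff[OF positive_abs_op[OF A]] by blast
  then show "A \<in> bounded_ops" "\<exists>C. trace_bounded A C"
    using trace_bounded_of_summable_abs[OF A E] A by blast+
next
  fix C assume A: "A \<in> bounded_ops" and bd: "trace_bounded A C"
  have "(\<lambda>e. cinner e (abs_op A e)) summable_on some_onb"
    using trace_bounded_summable_abs[OF A is_onb_some_onb bd]
      summable_on_cinner_positive_iff[OF positive_abs_op[OF A]] by blast
  then show "A \<in> trace_class"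
    using A is_onb_some_onb unfolding trace_class_def by blast
qed

lemma trace_norm_eq:
  assumes "A \<in> trace_class"
  shows "trace_norm A = (\<Sum>\<^sub>\<infinity>e\<in>some_onb. inner e (abs_op A e))"
proof -
  have A: "A \<in> bounded_ops" and "\<exists>C. trace_bounded A C"
    using assms by (auto simp: trace_class_iff)
  then have "(\<lambda>e. cinner e (abs_op A e)) summable_on some_onb"
    using trace_bounded_summable_abs[OF A is_onb_some_onb]
      summable_on_cinner_positive_iff[OF positive_abs_op[OF A]] by blast
  then show ?thesis
    unfolding trace_norm_def trace_op_def by (simp add: infsum_Re[symmetric] Re_cinner)
qed

lemma trace_bounded_trace_norm:
  assumes "A \<in> trace_class"
  shows "trace_bounded A (trace_norm A)"
  unfolding trace_norm_eq[OF assms]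
  using assms trace_bounded_summable_abs trace_bounded_of_summable_abs is_onb_some_onb
  unfolding trace_class_iff by blast

lemma trace_norm_le:
  assumes "A \<in> bounded_ops" "trace_bounded A C"
  shows "trace_norm A \<le> C"
proof -
  have "A \<in> trace_class"
    using assms unfolding trace_class_iff by blast
  then show ?thesis
    using trace_bounded_infsum_abs[OF assms(1) is_onb_some_onb assms(2)] by (simp add: trace_norm_eq)
qed

lemma trace_class_bounded_ops: "A \<in> trace_class \<Longrightarrow> A \<in> bounded_ops"
  by (simp add: trace_class_def)

lemma bounded_ops_add: "A \<in> bounded_ops \<Longrightarrow> B \<in> bounded_ops \<Longrightarrow> A + B \<in> bounded_ops"
  by (simp add: bounded_ops_def blinfun.add_left scaleC_add_right)

lemma bounded_ops_scaleC_op: "A \<in> bounded_ops \<Longrightarrow> scaleC_op c A \<in> bounded_ops"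
  by (simp add: bounded_ops_def scaleC_op.rep_eq scaleC_scaleC mult.commute)

lemma trace_class_add: "A \<in> trace_class \<Longrightarrow> B \<in> trace_class \<Longrightarrow> A + B \<in> trace_class"
  unfolding trace_class_iff using trace_bounded_add bounded_ops_add by blast

lemma trace_class_scaleC_op: "A \<in> trace_class \<Longrightarrow> scaleC_op c A \<in> trace_class"
  unfolding trace_class_iff using trace_bounded_scaleC_op bounded_ops_scaleC_op by blast

lemma trace_class_abs_summable:
  assumes "A \<in> trace_class"
  shows "(\<lambda>e. cmod (cinner e (A e))) summable_on some_onb"
    and "(\<Sum>\<^sub>\<infinity>e\<in>some_onb. cmod (cinner e (A e))) \<le> trace_norm A"
proof -
  have le: "(\<Sum>e\<in>F. cmod (cinner e (A e))) \<le> trace_norm A" if "finite F" "F \<subseteq> some_onb" for F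
    using trace_bounded_sum_diagonal[OF trace_bounded_trace_norm[OF assms] that(1)]
      orthonormal_subset[OF is_onb_orthonormal[OF is_onb_some_onb] that(2)] .
  show sm: "(\<lambda>e. cmod (cinner e (A e))) summable_on some_onb"
    by (rule nonneg_bdd_above_summable_on) (auto intro!: bdd_aboveI[of _ "trace_norm A"] le)
  show "(\<Sum>\<^sub>\<infinity>e\<in>some_onb. cmod (cinner e (A e))) \<le> trace_norm A"
    by (rule infsum_le_finite_sums[OF sm le])
qed

lemma trace_class_summable:
  "A \<in> trace_class \<Longrightarrow> (\<lambda>e. cinner e (A e)) summable_on some_onb"
  by (rule abs_summable_summable[OF trace_class_abs_summable(1)])

lemma cmod_trace_op_le: "A \<in> trace_class \<Longrightarrow> cmod (trace_op A) \<le> trace_norm A"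
  unfolding trace_op_def
  using norm_infsum_bound[OF trace_class_abs_summable(1)] trace_class_abs_summable(2) order_trans by blast

lemma cmod_cinner_diagonal_le:
  assumes "A \<in> trace_class" "norm e = 1"
  shows "cmod (cinner e (A e)) \<le> trace_norm A"
  using trace_bounded_sum_diagonal[OF trace_bounded_trace_norm[OF assms(1)], of "{e}"] assms(2)
  by (simp add: orthonormal_def)

lemma trace_op_add:
  assumes "A \<in> trace_class" "B \<in> trace_class"
  shows "trace_op (A + B) = trace_op A + trace_op B"
  unfolding trace_op_def
  by (simp add: blinfun.add_left cinner.add_right infsum_add trace_class_summable assms)

lemma trace_op_scaleC_op: "A \<in> trace_class \<Longrightarrow> trace_op (scaleC_op c A) = c * trace_op A"
  unfolding trace_op_def
  by (simp add: scaleC_op.rep_eq cinner_scaleC_right infsum_cmult_right trace_class_summable)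

section \<open>Relaxation towards an idempotent quantum operation\<close>

lemma scaleC_op_add_right: "scaleC_op c (A + B) = scaleC_op c A + scaleC_op c B"
  by (rule blinfun_eqI) (simp add: scaleC_op.rep_eq blinfun.add_left scaleC_add_right)

lemma scaleC_op_add_left: "scaleC_op (c + d) A = scaleC_op c A + scaleC_op d A"
  by (rule blinfun_eqI) (simp add: scaleC_op.rep_eq blinfun.add_left scaleC_add_left)

lemma scaleC_op_scaleC_op: "scaleC_op c (scaleC_op d A) = scaleC_op (c * d) A"
  by (rule blinfun_eqI) (simp add: scaleC_op.rep_eq scaleC_scaleC)

lemma scaleC_op_one: "scaleC_op 1 A = A"
  by (rule blinfun_eqI) (simp add: scaleC_op.rep_eq scaleC_one)

lemma scaleC_op_zero: "scaleC_op 0 A = 0"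
  by (rule blinfun_eqI) (simp add: scaleC_op.rep_eq scaleC.zero_left)

lemma trace_norm_add_le:
  "A \<in> trace_class \<Longrightarrow> B \<in> trace_class \<Longrightarrow> trace_norm (A + B) \<le> trace_norm A + trace_norm B"
  by (intro trace_norm_le trace_bounded_add trace_bounded_trace_norm bounded_ops_add trace_class_bounded_ops)

lemma trace_norm_scaleC_op_le:
  "A \<in> trace_class \<Longrightarrow> trace_norm (scaleC_op c A) \<le> cmod c * trace_norm A"
  by (intro trace_norm_le trace_bounded_scaleC_op trace_bounded_trace_norm bounded_ops_scaleC_op
      trace_class_bounded_ops)

definition relaxation :: "'a::chilbert_space superop \<Rightarrow> real \<Rightarrow> 'a superop" where
  "relaxation \<Psi> t \<rho> = scaleC_op (complex_of_real (exp (- t))) \<rho>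
     + scaleC_op (complex_of_real (1 - exp (- t))) (\<Psi> \<rho>)"

lemma linear_on_trace_classD:
  assumes "linear_on_trace_class \<Psi>"
  shows "\<rho> \<in> trace_class \<Longrightarrow> \<Psi> \<rho> \<in> trace_class"
    and "\<rho> \<in> trace_class \<Longrightarrow> \<sigma> \<in> trace_class \<Longrightarrow> \<Psi> (\<rho> + \<sigma>) = \<Psi> \<rho> + \<Psi> \<sigma>"
    and "\<rho> \<in> trace_class \<Longrightarrow> \<Psi> (scaleC_op c \<rho>) = scaleC_op c (\<Psi> \<rho>)"
  using assms by (simp_all add: linear_on_trace_class_def)

lemma quantum_operation_relaxation:
  assumes "quantum_operation \<Psi>" "t \<ge> 0"
  shows "quantum_operation (relaxation \<Psi> t)"
proof -
  define p q where "p = exp (- t)" and "q = 1 - exp (- t)"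
  have pq: "p \<ge> 0" "q \<ge> 0" "p + q = 1"
    using assms(2) by (simp_all add: p_def q_def)
  have R: "relaxation \<Psi> t \<rho> = scaleC_op (complex_of_real p) \<rho> + scaleC_op (complex_of_real q) (\<Psi> \<rho>)" for \<rho>
    by (simp add: relaxation_def p_def q_def)
  have lin: "linear_on_trace_class \<Psi>" and cp: "completely_positive \<Psi>" and tp: "trace_preserving \<Psi>"
    using assms(1) by (simp_all add: quantum_operation_def)
  note lins = linear_on_trace_classD[OF lin]
  have "linear_on_trace_class (relaxation \<Psi> t)"
    unfolding linear_on_trace_class_def R
    by (intro conjI ballI allI trace_class_add trace_class_scaleC_op lins)
      (simp_all add: lins scaleC_op_add_right scaleC_op_scaleC_op mult.commute)
  moreover have "completely_positive (relaxation \<Psi> t)"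
    unfolding completely_positive_def
  proof (intro allI impI, elim conjE)
    fix n and M :: "nat \<Rightarrow> nat \<Rightarrow> 'a \<Rightarrow>\<^sub>L 'a"
    assume tc: "\<forall>i<n. \<forall>j<n. M i j \<in> trace_class" and pos: "block_positive n M"
    then have pos': "block_positive n (\<lambda>i j. \<Psi> (M i j))"
      using cp unfolding completely_positive_def by blast
    show "block_positive n (\<lambda>i j. relaxation \<Psi> t (M i j))"
      unfolding block_positive_def
    proof
      fix x
      have "(\<Sum>i<n. \<Sum>j<n. cinner (x i) (relaxation \<Psi> t (M i j) (x j)))
        = complex_of_real p * (\<Sum>i<n. \<Sum>j<n. cinner (x i) (M i j (x j)))
        + complex_of_real q * (\<Sum>i<n. \<Sum>j<n. cinner (x i) (\<Psi> (M i j) (x j)))"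
        by (simp add: R blinfun.add_left scaleC_op.rep_eq cinner.add_right cinner_scaleC_right
            sum.distrib sum_distrib_left)
      also have "\<dots> \<in> \<real>\<^sub>\<ge>\<^sub>0"
        using pos pos' pq unfolding block_positive_def
        by (intro nonneg_Reals_add_I nonneg_Reals_mult_I) (auto simp: nonneg_Reals_of_real_iff)
      finally show "(\<Sum>i<n. \<Sum>j<n. cinner (x i) (relaxation \<Psi> t (M i j) (x j))) \<in> \<real>\<^sub>\<ge>\<^sub>0" .
    qed
  qed
  moreover have "trace_preserving (relaxation \<Psi> t)"
    unfolding trace_preserving_def
  proof
    fix \<rho> :: "'a \<Rightarrow>\<^sub>L 'a" assume \<rho>: "\<rho> \<in> trace_class"
    have "trace_op (relaxation \<Psi> t \<rho>) = complex_of_real (p + q) * trace_op \<rho>"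
      using tp \<rho> by (simp add: R trace_op_add trace_op_scaleC_op trace_class_scaleC_op lins
          trace_preserving_def distrib_right)
    then show "trace_op (relaxation \<Psi> t \<rho>) = trace_op \<rho>" using pq by simp
  qed
  ultimately show ?thesis by (simp add: quantum_operation_def)
qed

lemma superop_norm_le:
  assumes "\<And>\<rho>. \<rho> \<in> trace_class \<Longrightarrow> trace_norm (\<Psi> \<rho>) \<le> K * trace_norm \<rho>" and "K \<ge> 0"
  shows "superop_norm \<Psi> \<le> ennreal K"
  unfolding superop_norm_def
proof (rule SUP_least)
  fix \<rho> assume "\<rho> \<in> {\<rho> :: 'a \<Rightarrow>\<^sub>L 'a. \<rho> \<in> trace_class \<and> trace_norm \<rho> \<le> 1}"
  then have "trace_norm (\<Psi> \<rho>) \<le> K * trace_norm \<rho>" "K * trace_norm \<rho> \<le> K"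
    using assms by (auto simp: mult_left_le)
  then show "ennreal (trace_norm (\<Psi> \<rho>)) \<le> ennreal K"
    by (intro ennreal_leI) linarith
qed

text \<open>
  If \<open>\<Psi>\<close> is idempotent, then \<open>relaxation \<Psi> t\<close> is \<open>exp (t * (\<Psi> - I))\<close>; its increments are
  scalar multiples of \<open>I - \<Psi>\<close>, hence the norm continuity.
\<close>

lemma norm_continuous_quantum_semigroup_relaxation:
  fixes \<Psi> :: "'a::chilbert_space superop"
  assumes qo: "quantum_operation \<Psi>"
    and idem: "\<And>\<rho>. \<rho> \<in> trace_class \<Longrightarrow> \<Psi> (\<Psi> \<rho>) = \<Psi> \<rho>"
    and bound: "\<And>\<rho>. \<rho> \<in> trace_class \<Longrightarrow> trace_norm (\<Psi> \<rho>) \<le> K * trace_norm \<rho>" and K: "K \<ge> 0"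
  shows "norm_continuous_quantum_semigroup (relaxation \<Psi>)"
proof -
  have lin: "linear_on_trace_class \<Psi>"
    using qo by (simp add: quantum_operation_def)
  note lins = linear_on_trace_classD[OF lin]
  have "relaxation \<Psi> s (relaxation \<Psi> t \<rho>) = relaxation \<Psi> (s + t) \<rho>" if \<rho>: "\<rho> \<in> trace_class" for s t \<rho>
  proof -
    have "\<Psi> (relaxation \<Psi> t \<rho>)
        = scaleC_op (complex_of_real (exp (- t)) + complex_of_real (1 - exp (- t))) (\<Psi> \<rho>)"
      unfolding relaxation_def
      by (simp only: scaleC_op_add_left lins \<rho> idem trace_class_scaleC_op)
    then have "\<Psi> (relaxation \<Psi> t \<rho>) = \<Psi> \<rho>"
      by (simp add: scaleC_op_one)
    then have "relaxation \<Psi> s (relaxation \<Psi> t \<rho>)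
        = scaleC_op (complex_of_real (exp (- s) * exp (- t))) \<rho>
        + scaleC_op (complex_of_real (exp (- s) * (1 - exp (- t)) + (1 - exp (- s)))) (\<Psi> \<rho>)"
      unfolding relaxation_def[of _ s]
      by (simp only: relaxation_def[of _ t] scaleC_op_add_right scaleC_op_scaleC_op
          scaleC_op_add_left of_real_add of_real_mult add.assoc)
    also have "exp (- s) * exp (- t) = exp (- (s + t))"
      by (simp only: exp_add[symmetric] minus_add_distrib)
    also have "exp (- s) * (1 - exp (- t)) + (1 - exp (- s)) = 1 - exp (- (s + t))"
      by (simp only: minus_add_distrib exp_add) (simp add: algebra_simps)
    finally show ?thesis by (simp only: relaxation_def[of _ "s + t"])
  qed
  moreover have "relaxation \<Psi> 0 \<rho> = \<rho>" for \<rho>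
    by (simp add: relaxation_def scaleC_op_one scaleC_op_zero)
  moreover have "superop_norm (relaxation \<Psi> t) < \<infinity>" for t
  proof -
    have "trace_norm (relaxation \<Psi> t \<rho>) \<le> (exp (- t) + \<bar>1 - exp (- t)\<bar> * K) * trace_norm \<rho>"
      if \<rho>: "\<rho> \<in> trace_class" for \<rho>
    proof -
      have "trace_norm (relaxation \<Psi> t \<rho>) \<le> cmod (complex_of_real (exp (- t))) * trace_norm \<rho>
          + cmod (complex_of_real (1 - exp (- t))) * trace_norm (\<Psi> \<rho>)"
        unfolding relaxation_def
        by (intro order_trans[OF trace_norm_add_le add_mono] trace_norm_scaleC_op_le
            trace_class_scaleC_op lins \<rho>)
      also have "\<dots> \<le> exp (- t) * trace_norm \<rho> + \<bar>1 - exp (- t)\<bar> * (K * trace_norm \<rho>)"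
        using bound[OF \<rho>] by (simp only: norm_of_real abs_exp_cancel) (intro add_left_mono mult_left_mono, auto)
      finally show ?thesis by (simp add: algebra_simps)
    qed
    then have "superop_norm (relaxation \<Psi> t) \<le> ennreal (exp (- t) + \<bar>1 - exp (- t)\<bar> * K)"
      using K by (intro superop_norm_le) auto
    then show ?thesis by (rule le_less_trans) simp
  qed
  moreover have "((\<lambda>s. superop_norm (\<lambda>\<rho>. relaxation \<Psi> s \<rho> - relaxation \<Psi> t \<rho>)) \<longlongrightarrow> 0) (at t within {0..})"
    for t
  proof -
    define c where "c s = \<bar>exp (- s) - exp (- t)\<bar>" for s
    have le: "superop_norm (\<lambda>\<rho>. relaxation \<Psi> s \<rho> - relaxation \<Psi> t \<rho>) \<le> ennreal (c s * (1 + K))" for s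
    proof (rule superop_norm_le)
      fix \<rho> :: "'a \<Rightarrow>\<^sub>L 'a" assume \<rho>: "\<rho> \<in> trace_class"
      have "relaxation \<Psi> s \<rho> - relaxation \<Psi> t \<rho>
          = scaleC_op (complex_of_real (exp (- s) - exp (- t))) (\<rho> + scaleC_op (- 1) (\<Psi> \<rho>))"
        by (rule blinfun_eqI) (simp add: relaxation_def scaleC_op.rep_eq blinfun.add_left blinfun.diff_left
            scaleC.diff_left scaleC.add_right scaleC_scaleC scaleC.minus_left scaleC.minus_right
            scaleC_one algebra_simps)
      then have "trace_norm (relaxation \<Psi> s \<rho> - relaxation \<Psi> t \<rho>)
          \<le> cmod (complex_of_real (exp (- s) - exp (- t))) * trace_norm (\<rho> + scaleC_op (- 1) (\<Psi> \<rho>))"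
        by (simp only:) (intro trace_norm_scaleC_op_le trace_class_add trace_class_scaleC_op lins \<rho>)
      also have "\<dots> = c s * trace_norm (\<rho> + scaleC_op (- 1) (\<Psi> \<rho>))"
        by (simp only: norm_of_real c_def)
      also have "\<dots> \<le> c s * (trace_norm \<rho> + cmod (- 1) * trace_norm (\<Psi> \<rho>))"
        by (intro mult_left_mono order_trans[OF trace_norm_add_le add_left_mono] trace_norm_scaleC_op_le
            trace_class_scaleC_op lins \<rho>) (simp add: c_def)
      also have "\<dots> \<le> c s * (trace_norm \<rho> + K * trace_norm \<rho>)"
        using bound[OF \<rho>] by (intro mult_left_mono) (simp_all add: c_def)
      finally show "trace_norm (relaxation \<Psi> s \<rho> - relaxation \<Psi> t \<rho>) \<le> c s * (1 + K) * trace_norm \<rho>"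
        by (simp add: algebra_simps)
    qed (use K in \<open>simp add: c_def\<close>)
    have "((\<lambda>s. c s * (1 + K)) \<longlongrightarrow> c t * (1 + K)) (at t within {0..})"
      unfolding c_def by (intro tendsto_intros)
    then have "((\<lambda>s. ennreal (c s * (1 + K))) \<longlongrightarrow> ennreal (c t * (1 + K))) (at t within {0..})"
      by (rule tendsto_ennrealI)
    then have "((\<lambda>s. ennreal (c s * (1 + K))) \<longlongrightarrow> 0) (at t within {0..})"
      by (simp add: c_def)
    then show ?thesis
      by (rule tendsto_sandwich[OF _ _ tendsto_const, rotated 2]) (auto simp: le)
  qed
  ultimately show ?thesis
    unfolding norm_continuous_quantum_semigroup_def
    using quantum_operation_relaxation[OF qo] by blast
qed

section \<open>Rank one projections\<close>

definition rank_one_projection :: "'a::complex_inner \<Rightarrow> 'a \<Rightarrow>\<^sub>L 'a" where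
  "rank_one_projection e = Blinfun (\<lambda>x. cinner e x *\<^sub>C e)"

lemma rank_one_projection_apply: "rank_one_projection e x = cinner e x *\<^sub>C e"
  unfolding rank_one_projection_def
  by (subst bounded_linear_Blinfun_apply)
    (auto intro: bounded_linear_compose[OF scaleC.bounded_linear_left cinner.bounded_linear_right])

lemma cinner_rank_one_projection: "cinner x (rank_one_projection e x) = complex_of_real ((cmod (cinner e x))\<^sup>2)"
  unfolding rank_one_projection_apply cinner_scaleC_right
  by (metis cinner_commute complex_norm_square)

lemma rank_one_projection_bounded_ops: "rank_one_projection e \<in> bounded_ops"
  by (simp add: bounded_ops_def rank_one_projection_apply cinner_scaleC_right scaleC_scaleC)

lemma positive_rank_one_projection: "positive_op (rank_one_projection e)"
  unfolding positive_op_def cinner_rank_one_projection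
  by (simp add: rank_one_projection_bounded_ops nonneg_Reals_of_real_iff)

lemma trace_bounded_rank_one_projection:
  fixes e :: "'a::chilbert_space"
  assumes e: "norm e = 1"
  shows "trace_bounded (rank_one_projection e) 1"
  unfolding trace_bounded_def
proof (intro allI impI, elim conjE)
  fix W :: "'a \<Rightarrow>\<^sub>L 'a" and F :: "'a set"
  assume W: "W \<in> bounded_ops" "norm W \<le> 1" and F: "finite F" "orthonormal F"
  define v where "v = adjoint_op W e"
  have "norm v \<le> norm (adjoint_op W) * norm e"
    unfolding v_def by (rule norm_blinfun)
  then have v: "norm v \<le> 1"
    using norm_adjoint_le[OF W(1)] W(2) e by simp
  have "cmod (cinner (W f) (rank_one_projection e f)) \<le> ((cmod (cinner f e))\<^sup>2 + (cmod (cinner f v))\<^sup>2) / 2" for f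
  proof -
    have "cmod (cinner (W f) (rank_one_projection e f)) = cmod (cinner f e) * cmod (cinner f v)"
      by (simp add: rank_one_projection_apply cinner_scaleC_right norm_mult v_def cinner_adjoint_right[OF W(1)])
        (metis cinner_commute complex_mod_cnj)
    then show ?thesis
      using sum_squares_bound[of "cmod (cinner f e)" "cmod (cinner f v)"] by simp
  qed
  then have "(\<Sum>f\<in>F. cmod (cinner (W f) (rank_one_projection e f)))
      \<le> (\<Sum>f\<in>F. ((cmod (cinner f e))\<^sup>2 + (cmod (cinner f v))\<^sup>2) / 2)"
    by (rule sum_mono)
  also have "\<dots> = ((\<Sum>f\<in>F. (cmod (cinner f e))\<^sup>2) + (\<Sum>f\<in>F. (cmod (cinner f v))\<^sup>2)) / 2"
    by (simp add: sum_divide_distrib[symmetric] sum.distrib)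
  also have "\<dots> \<le> ((norm e)\<^sup>2 + (norm v)\<^sup>2) / 2"
    using bessel_inequality[OF F] by (intro divide_right_mono add_mono) auto
  also have "\<dots> \<le> 1"
    using e v by (simp add: power_le_one)
  finally show "(\<Sum>f\<in>F. cmod (cinner (W f) (rank_one_projection e f))) \<le> 1" .
qed

lemma rank_one_projection_trace_class:
  "norm e = 1 \<Longrightarrow> rank_one_projection e \<in> (trace_class :: ('a::chilbert_space \<Rightarrow>\<^sub>L 'a) set)"
  unfolding trace_class_iff
  using rank_one_projection_bounded_ops trace_bounded_rank_one_projection by blast

lemma trace_norm_rank_one_projection_le:
  "norm (e :: 'a::chilbert_space) = 1 \<Longrightarrow> trace_norm (rank_one_projection e) \<le> 1"
  by (intro trace_norm_le rank_one_projection_bounded_ops trace_bounded_rank_one_projection)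

lemma norm_some_onb: "e \<in> some_onb \<Longrightarrow> norm e = 1"
  using is_onb_some_onb by (auto simp: is_onb_def)

lemma cinner_some_onb: "e \<in> some_onb \<Longrightarrow> f \<in> some_onb \<Longrightarrow> cinner e f = (if e = f then 1 else 0)"
  by (rule orthonormal_cinner[OF is_onb_orthonormal[OF is_onb_some_onb]])

lemma has_sum_trace_rank_one_compose:
  assumes "k \<in> some_onb"
  shows "((\<lambda>e. cinner e ((rank_one_projection k o\<^sub>L B) e)) has_sum cinner k (B k)) some_onb"
  by (rule has_sum_finite_neutralI[of "{k}"])
    (use assms in \<open>auto simp: rank_one_projection_apply cinner_scaleC_right cinner_some_onb\<close>)

lemma trace_rank_one_projection:
  assumes "k \<in> some_onb"
  shows "trace_op (rank_one_projection k) = 1"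
  using infsumI[OF has_sum_trace_rank_one_compose[OF assms, of id_blinfun]] assms
  by (simp add: trace_op_def cinner_some_onb)

lemma density_rank_one_projection: "k \<in> some_onb \<Longrightarrow> density_operator (rank_one_projection k)"
  by (simp add: density_operator_def rank_one_projection_trace_class norm_some_onb
      positive_rank_one_projection trace_rank_one_projection)

section \<open>Absorption by two basis states\<close>

text \<open>
  For distinct basis vectors \<open>e\<close> and \<open>f\<close> this is \<open>tr (\<rho> Q)\<close> with \<open>Q = (1 + P\<^sub>e - P\<^sub>f) / 2\<close>: the
  probability of ending up in \<open>e\<close> when \<open>e\<close> and \<open>f\<close> are absorbing and their orthogonal complement
  decays to each of them with equal probability.
\<close>

definition absorption_weight :: "'a::chilbert_space \<Rightarrow> 'a \<Rightarrow> ('a \<Rightarrow>\<^sub>L 'a) \<Rightarrow> complex" where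
  "absorption_weight e f \<rho> = (trace_op \<rho> + cinner e (\<rho> e) - cinner f (\<rho> f)) / 2"

definition absorption :: "'a::chilbert_space \<Rightarrow> 'a \<Rightarrow> 'a superop" where
  "absorption e f \<rho> = scaleC_op (absorption_weight e f \<rho>) (rank_one_projection e)
     + scaleC_op (absorption_weight f e \<rho>) (rank_one_projection f)"

definition absorption_effect :: "'a::chilbert_space \<Rightarrow> 'a \<Rightarrow> 'a \<Rightarrow>\<^sub>L 'a" where
  "absorption_effect e f =
     scaleC_op (1/2) (id_blinfun + rank_one_projection e + scaleC_op (- 1) (rank_one_projection f))"

lemma absorption_weight_add:
  "\<rho> \<in> trace_class \<Longrightarrow> \<sigma> \<in> trace_class
    \<Longrightarrow> absorption_weight e f (\<rho> + \<sigma>) = absorption_weight e f \<rho> + absorption_weight e f \<sigma>"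
  by (simp add: absorption_weight_def trace_op_add blinfun.add_left cinner.add_right add_divide_distrib
      diff_divide_distrib)

lemma absorption_weight_scaleC_op:
  "\<rho> \<in> trace_class \<Longrightarrow> absorption_weight e f (scaleC_op c \<rho>) = c * absorption_weight e f \<rho>"
  by (simp add: absorption_weight_def trace_op_scaleC_op scaleC_op.rep_eq cinner_scaleC_right algebra_simps)

lemma absorption_weight_sum:
  fixes A :: "'i \<Rightarrow> 'a::chilbert_space \<Rightarrow>\<^sub>L 'a"
  assumes "finite I" "\<And>i. i \<in> I \<Longrightarrow> A i \<in> trace_class"
  shows "(\<Sum>i\<in>I. A i) \<in> trace_class \<and>
    absorption_weight e f (\<Sum>i\<in>I. A i) = (\<Sum>i\<in>I. absorption_weight e f (A i))"
  using assms
proof (induction I rule: finite_induct)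
  case empty
  have "trace_bounded (0 :: 'a \<Rightarrow>\<^sub>L 'a) 0"
    by (simp add: trace_bounded_def cinner.zero_right)
  then show ?case
    by (auto simp: trace_class_iff bounded_ops_def absorption_weight_def trace_op_def cinner.zero_right
        scaleC.zero_right)
next
  case (insert i I)
  then show ?case by (simp add: trace_class_add absorption_weight_add)
qed

lemma absorption_weight_nonneg:
  assumes tc: "\<rho> \<in> trace_class" and pos: "positive_op \<rho>" and e: "e \<in> some_onb" and f: "f \<in> some_onb"
  shows "absorption_weight e f \<rho> \<in> \<real>\<^sub>\<ge>\<^sub>0"
proof -
  define d where "d g = inner g (\<rho> g)" for g
  have d: "cinner g (\<rho> g) = complex_of_real (d g)" and d0: "d g \<ge> 0" for g
    unfolding d_def using positive_op_cinner[OF pos] positive_op_inner_nonneg[OF pos] by auto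
  have sm: "d summable_on some_onb"
    using trace_class_summable[OF tc] unfolding summable_on_cinner_positive_iff[OF pos] d_def .
  have "trace_op \<rho> = complex_of_real (infsum d some_onb)"
    unfolding trace_op_def d by (rule infsumI[OF has_sum_of_real[OF has_sum_infsum[OF sm]]])
  then have "absorption_weight e f \<rho> = complex_of_real ((infsum d some_onb + d e - d f) / 2)"
    by (simp add: absorption_weight_def d)
  moreover have "sum d {f} \<le> infsum d some_onb"
    by (rule finite_sum_le_infsum[OF sm]) (use f d0 in auto)
  ultimately show ?thesis
    using d0[of e] by (simp only: nonneg_Reals_of_real_iff) simp
qed

text \<open>
  The weights are completely positive: the compression of a positive block matrix by a vector
  of scalars \<open>c\<close> is a single positive operator.
\<close>

lemma absorption_weight_block_nonneg:
  assumes tc: "\<forall>i<n. \<forall>j<n. R i j \<in> trace_class" and pos: "block_positive n R"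
    and e: "e \<in> some_onb" and f: "f \<in> some_onb"
  shows "(\<Sum>i<n. \<Sum>j<n. cnj (c i) * c j * absorption_weight e f (R i j)) \<in> \<real>\<^sub>\<ge>\<^sub>0"
proof -
  define I where "I = {..<n} \<times> {..<n}"
  define A where "A = (\<lambda>(i,j). scaleC_op (cnj (c i) * c j) (R i j))"
  have A: "A p \<in> trace_class" if "p \<in> I" for p
    using that tc by (auto simp: I_def A_def intro: trace_class_scaleC_op)
  have sum: "(\<Sum>p\<in>I. A p) \<in> trace_class"
    "absorption_weight e f (\<Sum>p\<in>I. A p) = (\<Sum>p\<in>I. absorption_weight e f (A p))"
    using absorption_weight_sum[of I A e f] A by (auto simp: I_def)
  have "positive_op (\<Sum>p\<in>I. A p)"
    unfolding positive_op_def
  proof (intro conjI allI trace_class_bounded_ops sum)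
    fix v
    have "cinner v ((\<Sum>p\<in>I. A p) v) = (\<Sum>i<n. \<Sum>j<n. cinner v (A (i,j) v))"
      by (simp add: I_def blinfun.sum_left cinner.sum_right sum.cartesian_product)
    also have "\<dots> = (\<Sum>i<n. \<Sum>j<n. cinner (c i *\<^sub>C v) (R i j (c j *\<^sub>C v)))"
    proof (intro sum.cong refl)
      fix i j assume "i \<in> {..<n}" "j \<in> {..<n}"
      then have "R i j \<in> bounded_ops"
        using tc by (auto intro: trace_class_bounded_ops)
      then show "cinner v (A (i,j) v) = cinner (c i *\<^sub>C v) (R i j (c j *\<^sub>C v))"
        by (simp add: A_def scaleC_op.rep_eq bounded_ops_scaleC cinner_scaleC_left cinner_scaleC_right)
    qed
    also have "\<dots> \<in> \<real>\<^sub>\<ge>\<^sub>0"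
      using pos[unfolded block_positive_def, THEN spec, of "\<lambda>i. c i *\<^sub>C v"] .
    finally show "cinner v ((\<Sum>p\<in>I. A p) v) \<in> \<real>\<^sub>\<ge>\<^sub>0" .
  qed
  then have "(\<Sum>p\<in>I. absorption_weight e f (A p)) \<in> \<real>\<^sub>\<ge>\<^sub>0"
    using absorption_weight_nonneg[OF sum(1) _ e f] sum(2) by simp
  also have "(\<Sum>p\<in>I. absorption_weight e f (A p))
      = (\<Sum>i<n. \<Sum>j<n. cnj (c i) * c j * absorption_weight e f (R i j))"
    unfolding I_def sum.cartesian_product using tc
    by (intro sum.cong refl) (auto simp: A_def absorption_weight_scaleC_op)
  finally show ?thesis .
qed

context
  fixes e f :: "'a::chilbert_space"
  assumes e: "e \<in> some_onb" and f: "f \<in> some_onb" and ef: "e \<noteq> f"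
begin

lemma absorption_trace_class: "absorption e f \<rho> \<in> trace_class"
  unfolding absorption_def
  by (intro trace_class_add trace_class_scaleC_op rank_one_projection_trace_class norm_some_onb e f)

lemma trace_op_absorption: "trace_op (absorption e f \<rho>) = trace_op \<rho>"
proof -
  have "trace_op (absorption e f \<rho>) = absorption_weight e f \<rho> + absorption_weight f e \<rho>"
    unfolding absorption_def
    by (simp add: trace_op_add trace_op_scaleC_op trace_class_scaleC_op rank_one_projection_trace_class
        norm_some_onb e f trace_rank_one_projection)
  then show ?thesis
    by (simp add: absorption_weight_def add_divide_distrib diff_divide_distrib)
qed

lemma absorption_weight_absorption:
  "absorption_weight e f (absorption e f \<rho>) = absorption_weight e f \<rho>"
  "absorption_weight f e (absorption e f \<rho>) = absorption_weight f e \<rho>"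
proof -
  have "cinner e (absorption e f \<rho> e) = absorption_weight e f \<rho>"
    "cinner f (absorption e f \<rho> f) = absorption_weight f e \<rho>"
    using ef by (simp_all add: absorption_def blinfun.add_left scaleC_op.rep_eq rank_one_projection_apply
        cinner.add_right cinner_scaleC_right cinner_some_onb e f)
  then show "absorption_weight e f (absorption e f \<rho>) = absorption_weight e f \<rho>"
    "absorption_weight f e (absorption e f \<rho>) = absorption_weight f e \<rho>"
    by (simp_all add: absorption_weight_def[of _ _ "absorption e f \<rho>"] trace_op_absorption)
      (simp_all add: absorption_weight_def field_simps)
qed

lemma absorption_idempotent: "absorption e f (absorption e f \<rho>) = absorption e f \<rho>"
  unfolding absorption_def[of _ _ "absorption e f \<rho>"] absorption_weight_absorption
  by (simp add: absorption_def)

lemma trace_norm_absorption_le: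
  assumes \<rho>: "\<rho> \<in> trace_class"
  shows "trace_norm (absorption e f \<rho>) \<le> 3 * trace_norm \<rho>"
proof -
  have w: "cmod (absorption_weight a b \<rho>) \<le> 3 / 2 * trace_norm \<rho>" if "a \<in> some_onb" "b \<in> some_onb" for a b
  proof -
    have "cmod (trace_op \<rho> + cinner a (\<rho> a) - cinner b (\<rho> b))
        \<le> cmod (trace_op \<rho>) + cmod (cinner a (\<rho> a)) + cmod (cinner b (\<rho> b))"
      by (meson norm_triangle_ineq norm_triangle_ineq4 add_right_mono order_trans)
    also have "\<dots> \<le> trace_norm \<rho> + trace_norm \<rho> + trace_norm \<rho>"
      by (intro add_mono cmod_trace_op_le cmod_cinner_diagonal_le norm_some_onb \<rho> that)
    finally show ?thesis by (simp add: absorption_weight_def norm_divide)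
  qed
  have summand: "trace_norm (scaleC_op c (rank_one_projection a)) \<le> cmod c" if "a \<in> some_onb" for a :: 'a and c
  proof -
    have "trace_norm (scaleC_op c (rank_one_projection a)) \<le> cmod c * trace_norm (rank_one_projection a)"
      by (intro trace_norm_scaleC_op_le rank_one_projection_trace_class norm_some_onb that)
    also have "\<dots> \<le> cmod c * 1"
      by (intro mult_left_mono trace_norm_rank_one_projection_le norm_some_onb that) simp
    finally show ?thesis by simp
  qed
  have "trace_norm (absorption e f \<rho>)
      \<le> cmod (absorption_weight e f \<rho>) + cmod (absorption_weight f e \<rho>)"
    unfolding absorption_def
    by (intro order_trans[OF trace_norm_add_le add_mono] summand trace_class_scaleC_op
        rank_one_projection_trace_class norm_some_onb e f)
  also have "\<dots> \<le> 3 / 2 * trace_norm \<rho> + 3 / 2 * trace_norm \<rho>"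
    by (intro add_mono w e f)
  finally show ?thesis by simp
qed

lemma completely_positive_absorption: "completely_positive (absorption e f)"
  unfolding completely_positive_def block_positive_def[of _ "\<lambda>i j. absorption e f (_ i j)"]
proof (intro allI impI, elim conjE)
  fix n and R :: "nat \<Rightarrow> nat \<Rightarrow> 'a \<Rightarrow>\<^sub>L 'a" and x
  assume tc: "\<forall>i<n. \<forall>j<n. R i j \<in> trace_class" and pos: "block_positive n R"
  have summand: "cinner (x i) (absorption e f (R i j) (x j))
      = cnj (cinner e (x i)) * cinner e (x j) * absorption_weight e f (R i j)
      + cnj (cinner f (x i)) * cinner f (x j) * absorption_weight f e (R i j)" for i j
    by (simp add: absorption_def blinfun.add_left scaleC_op.rep_eq rank_one_projection_apply
        cinner.add_right cinner_scaleC_right cinner_commute[symmetric] mult_ac)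
  show "(\<Sum>i<n. \<Sum>j<n. cinner (x i) (absorption e f (R i j) (x j))) \<in> \<real>\<^sub>\<ge>\<^sub>0"
    unfolding summand sum.distrib
    by (intro nonneg_Reals_add_I absorption_weight_block_nonneg[OF tc pos] e f)
qed

lemma quantum_operation_absorption: "quantum_operation (absorption e f)"
proof -
  have "linear_on_trace_class (absorption e f)"
    unfolding linear_on_trace_class_def
    by (intro conjI ballI allI absorption_trace_class)
      (simp_all add: absorption_def absorption_weight_add absorption_weight_scaleC_op
        scaleC_op_add_left scaleC_op_add_right scaleC_op_scaleC_op)
  then show ?thesis
    unfolding quantum_operation_def trace_preserving_def
    by (simp add: completely_positive_absorption trace_op_absorption)
qed

lemma absorption_effect_apply:
  "absorption_effect e f x = (1/2) *\<^sub>C (x + cinner e x *\<^sub>C e - cinner f x *\<^sub>C f)"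
  by (simp add: absorption_effect_def scaleC_op.rep_eq blinfun.add_left rank_one_projection_apply
      scaleC.minus_left scaleC_one)

lemma positive_absorption_effect: "positive_op (absorption_effect e f)"
  unfolding positive_op_def
proof (intro conjI allI)
  show "absorption_effect e f \<in> bounded_ops"
    unfolding absorption_effect_def
    by (intro bounded_ops_scaleC_op bounded_ops_add rank_one_projection_bounded_ops)
      (simp add: bounded_ops_def)
  fix x
  have "cinner x (absorption_effect e f x)
      = complex_of_real (((norm x)\<^sup>2 + (cmod (cinner e x))\<^sup>2 - (cmod (cinner f x))\<^sup>2) / 2)"
    using cinner_rank_one_projection[of x e] cinner_rank_one_projection[of x f]
    by (simp add: absorption_effect_apply rank_one_projection_apply cinner_scaleC_right cinner.add_right
        cinner.diff_right cinner_self)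
  moreover have "(cmod (cinner f x))\<^sup>2 \<le> (norm x)\<^sup>2"
    using cmod_cinner_le[of f x] norm_some_onb[OF f] by (simp add: power_mono)
  then have "0 \<le> ((norm x)\<^sup>2 + (cmod (cinner e x))\<^sup>2 - (cmod (cinner f x))\<^sup>2) / 2"
    using zero_le_power2[of "cmod (cinner e x)"] by argo
  ultimately show "cinner x (absorption_effect e f x) \<in> \<real>\<^sub>\<ge>\<^sub>0"
    by (simp only: nonneg_Reals_of_real_iff)
qed

lemma trace_op_compose_absorption_effect:
  assumes \<rho>: "\<rho> \<in> trace_class"
  shows "trace_op (\<rho> o\<^sub>L absorption_effect e f) = absorption_weight e f \<rho>"
proof -
  have diag: "((\<lambda>g. cinner k g * cinner g (\<rho> k)) has_sum cinner k (\<rho> k)) some_onb" if "k \<in> some_onb" for k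
    by (rule has_sum_finite_neutralI[of "{k}"]) (use that in \<open>auto simp: cinner_some_onb\<close>)
  have sum: "((\<lambda>g. 1/2 * (cinner g (\<rho> g) + cinner e g * cinner g (\<rho> e) + - (cinner f g * cinner g (\<rho> f))))
      has_sum 1/2 * (trace_op \<rho> + cinner e (\<rho> e) + - cinner f (\<rho> f))) some_onb"
    unfolding trace_op_def
    by (intro has_sum_cmult_right has_sum_add has_sum_uminusI diag e f has_sum_infsum trace_class_summable \<rho>)
  have diagonal: "cinner g ((\<rho> o\<^sub>L absorption_effect e f) g)
      = 1/2 * (cinner g (\<rho> g) + cinner e g * cinner g (\<rho> e) + - (cinner f g * cinner g (\<rho> f)))" for g
    by (simp add: absorption_effect_apply bounded_ops_scaleC[OF trace_class_bounded_ops[OF \<rho>]]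
        blinfun.add_right blinfun.diff_right cinner_scaleC_right cinner.add_right cinner.diff_right)
  show ?thesis
    unfolding trace_op_def[of "\<rho> o\<^sub>L _"] diagonal infsumI[OF sum]
    by (simp add: absorption_weight_def)
qed

lemma norm_continuous_quantum_semigroup_absorption:
  "norm_continuous_quantum_semigroup (relaxation (absorption e f))"
  by (rule norm_continuous_quantum_semigroup_relaxation[where K = 3])
    (simp_all add: quantum_operation_absorption absorption_idempotent trace_norm_absorption_le)

text \<open>The absorption probability is unchanged by absorption, hence constant along the relaxation.\<close>

lemma absorption_effect_constant: "absorption_effect e f \<in> constants (relaxation (absorption e f))"
  unfolding constants_def
proof (intro CollectI conjI allI impI)
  show "absorption_effect e f \<in> bounded_ops"
    by (rule positive_op_bounded_ops[OF positive_absorption_effect])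
  fix \<rho> :: "'a \<Rightarrow>\<^sub>L 'a" and t :: real
  assume "density_operator \<rho>"
  then have \<rho>: "\<rho> \<in> trace_class" by (simp add: density_operator_def)
  have "relaxation (absorption e f) t \<rho> \<in> trace_class"
    unfolding relaxation_def by (intro trace_class_add trace_class_scaleC_op absorption_trace_class \<rho>)
  moreover have "absorption_weight e f (relaxation (absorption e f) t \<rho>) = absorption_weight e f \<rho>"
    unfolding relaxation_def
    by (simp add: absorption_weight_add absorption_weight_scaleC_op trace_class_scaleC_op
        absorption_trace_class \<rho> absorption_weight_absorption algebra_simps)
  ultimately show "trace_op (relaxation (absorption e f) t \<rho> o\<^sub>L absorption_effect e f)
      = trace_op (\<rho> o\<^sub>L absorption_effect e f)"
    by (simp add: trace_op_compose_absorption_effect \<rho>)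
qed

text \<open>
  A third basis vector \<open>k\<close> distinguishes the square: it has eigenvalue \<open>1/4\<close> at \<open>k\<close>, whereas its mean
  over the states \<open>e\<close> and \<open>f\<close> reached from \<open>k\<close> is \<open>(1 + 0) / 2\<close>.
\<close>

lemma absorption_effect_square_not_constant:
  assumes k: "k \<in> some_onb" "k \<noteq> e" "k \<noteq> f"
  shows "absorption_effect e f o\<^sub>L absorption_effect e f \<notin> constants (relaxation (absorption e f))"
proof
  define B where "B = absorption_effect e f o\<^sub>L absorption_effect e f"
  assume "absorption_effect e f o\<^sub>L absorption_effect e f \<in> constants (relaxation (absorption e f))"
  then have eq: "trace_op (relaxation (absorption e f) 1 (rank_one_projection k) o\<^sub>L B)
      = trace_op (rank_one_projection k o\<^sub>L B)"
    unfolding constants_def B_def using density_rank_one_projection[OF k(1)] by fastforce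
  have half: "(1/2) *\<^sub>C (v + v) = v" for v :: 'a
    by (simp add: scaleC_add_right scaleC_add_left[symmetric] scaleC_one)
  have eff: "absorption_effect e f e = e" "absorption_effect e f f = 0" "absorption_effect e f k = (1/2) *\<^sub>C k"
    using ef k by (simp_all add: absorption_effect_apply cinner_some_onb e f scaleC_one scaleC.zero_left
        scaleC.zero_right half)
  have B: "cinner e (B e) = 1" "cinner f (B f) = 0" "cinner k (B k) = 1/4"
    using k by (simp_all add: B_def eff bounded_ops_scaleC[OF positive_op_bounded_ops[OF positive_absorption_effect]]
        scaleC_scaleC cinner_scaleC_right cinner_some_onb e blinfun.zero_right cinner.zero_right)
  have w: "absorption_weight e f (rank_one_projection k) = 1/2" "absorption_weight f e (rank_one_projection k) = 1/2"
    using k by (simp_all add: absorption_weight_def trace_rank_one_projection rank_one_projection_apply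
        cinner_scaleC_right cinner_some_onb e f scaleC.zero_left cinner.zero_right)
  define p :: complex where "p = complex_of_real (exp (- 1))"
  have "((\<lambda>g. p * cinner g ((rank_one_projection k o\<^sub>L B) g)
        + (1 - p) * (1/2 * cinner g ((rank_one_projection e o\<^sub>L B) g)
                    + 1/2 * cinner g ((rank_one_projection f o\<^sub>L B) g)))
      has_sum p * cinner k (B k) + (1 - p) * (1/2 * cinner e (B e) + 1/2 * cinner f (B f))) some_onb"
    by (intro has_sum_cmult_right has_sum_add has_sum_trace_rank_one_compose e f k)
  moreover have "cinner g ((relaxation (absorption e f) 1 (rank_one_projection k) o\<^sub>L B) g)
      = p * cinner g ((rank_one_projection k o\<^sub>L B) g)
        + (1 - p) * (1/2 * cinner g ((rank_one_projection e o\<^sub>L B) g)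
                    + 1/2 * cinner g ((rank_one_projection f o\<^sub>L B) g))" for g
    by (simp add: relaxation_def absorption_def w blinfun.add_left scaleC_op.rep_eq cinner_scaleC_right
        cinner.add_right p_def)
  ultimately have "trace_op (relaxation (absorption e f) 1 (rank_one_projection k) o\<^sub>L B)
      = p * (1/4) + (1 - p) * (1/2)"
    unfolding trace_op_def by (simp add: infsumI B)
  moreover have "trace_op (rank_one_projection k o\<^sub>L B) = 1/4"
    unfolding trace_op_def using infsumI[OF has_sum_trace_rank_one_compose[OF k(1), of B]] by (simp add: B)
  ultimately have "p * (1/4) + (1 - p) * (1/2) = 1/4" using eq by simp
  then have "p = 1" by (simp add: field_simps)
  then show False by (simp add: p_def)
qed

end

lemma infinite_some_onb:
  assumes "\<not> (\<exists>B :: 'a::chilbert_space set. finite B \<and> cspan B = UNIV)"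
  shows "infinite (some_onb :: 'a set)"
  using assms cspan_finite_onb[OF is_onb_some_onb] by blast

theorem theorem5p12:
  assumes separable: "\<exists>D :: 'a::chilbert_space set. countable D \<and> closure D = UNIV"
    and infinite_dimensional: "\<not> (\<exists>B :: 'a set. finite B \<and> cspan B = UNIV)"
  shows "\<exists>\<Phi> :: real \<Rightarrow> 'a superop.
    norm_continuous_quantum_semigroup \<Phi>
    \<and> (\<not> von_neumann_algebra (constants \<Phi>)
        \<and> \<not> (\<forall>A\<in>constants \<Phi>. \<forall>B\<in>constants \<Phi>. A o\<^sub>L B \<in> constants \<Phi>))
    \<and> (\<exists>A. positive_op A \<and> A \<in> constants \<Phi> \<and> A o\<^sub>L A \<notin> constants \<Phi>)"
proof -
  obtain T :: "'a set" where "finite T" "card T = 3" "T \<subseteq> some_onb"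
    using infinite_arbitrarily_large[OF infinite_some_onb[OF infinite_dimensional]] by metis
  then obtain e f k :: 'a where k: "e \<in> some_onb" "f \<in> some_onb" "e \<noteq> f" "k \<in> some_onb" "k \<noteq> e" "k \<noteq> f"
    by (auto simp: card_3_iff)
  define \<Phi> where "\<Phi> = relaxation (absorption e f)"
  define A where "A = absorption_effect e f"
  have sg: "norm_continuous_quantum_semigroup \<Phi>"
    unfolding \<Phi>_def by (rule norm_continuous_quantum_semigroup_absorption[OF k(1-3)])
  have A: "positive_op A" "A \<in> constants \<Phi>" "A o\<^sub>L A \<notin> constants \<Phi>"
    unfolding \<Phi>_def A_def
    by (rule positive_absorption_effect[OF k(1-3)] absorption_effect_constant[OF k(1-3)]
        absorption_effect_square_not_constant[OF k])+
  have not_mult: "\<not> (\<forall>A\<in>constants \<Phi>. \<forall>B\<in>constants \<Phi>. A o\<^sub>L B \<in> constants \<Phi>)"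
    using A by blast
  then have "\<not> von_neumann_algebra (constants \<Phi>)"
    unfolding von_neumann_algebra_def by blast
  with sg A not_mult show ?thesis by blast
qed

end
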